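(* $\mathsf{ATR}_2 \leq_W \mathsf{LPO} \ast \mathsf{KDT}$. In particular, $\mathsf{ATR}_2 \leq_c \mathsf{KDT}$ and $\mathsf{ATR}_2 \leq_W^{\mathrm{arith}} \mathsf{KDT}$.
   Context: Problems are (possibly partial) multivalued functions between represented spaces. $P \leq_W Q$ (Weihrauch reducibility): there are computable partial $\Phi,\Psi:\subseteq \mathbb{N}^\mathbb{N}\to\mathbb{N}^\mathbb{N}$ such that for each name $p$ of a $P$-instance, $\Phi(p)$ names a $Q$-instance, and for each name $q$ of a $Q$-solution to it, $\Psi(p\oplus q)$ names a $P$-solution to the instance named by $p$. $P\leq_W^{\mathrm{arith}} Q$: the same with $\Phi,\Psi$ arithmetically defined (equivalently, computable with access to a fixed finite Turing jump of their inputs). $P\leq_c Q$ (computable reducibility): from any name $p$ of a $P$-instance one can compute a name $p'$ of a $Q$-instance such that for every name $q$ of a $Q$-solution to it, $p\oplus q$ computes a name of a $P$-solution to $p$ (non-uniformly). The composition $Q\circ P$ has domain $\{x: P(x)\subseteq\mathrm{dom}(Q)\}$ and values $\{z:\exists y\in P(x)\,(z\in Q(y))\}$; the compositional product is $Q\ast P=\sup\{Q_0\circ P_0: Q_0\leq_W Q, P_0\leq_W P\}$ in the Weihrauch degrees (this supremum exists). $\mathsf{LPO}$: given $p\in\mathbb{N}^\mathbb{N}$, output $1$ if $p(k)=0$ for some $k$, else output $0$. Linear orderings on subsets of $\mathbb{N}$ are represented by $\{\langle a,b\rangle: a\leq_L b\}$. A jump hierarchy on a linear ordering $L$ with first element $0_L$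 starting with $A\subseteq\mathbb{N}$ is $\langle X_a\rangle_{a\in L}$ with $X_{0_L}=A$ and $X_b=(\bigoplus_{a<_Lb}X_a)'$ for all $b>_L0_L$. $\mathsf{ATR}_2$: given a linear ordering $L$ and a set $A\subseteq\mathbb{N}$, produce either an infinite $<_L$-descending sequence or a jump hierarchy on $L$ starting with $A$, together with an indication of which type of solution is produced. $\mathsf{KDT}$: given a countable bipartite graph $G$ (represented by its vertex set and edge relation), produce a König cover $(C,M)$: $M$ is a matching (set of pairwise vertex-disjoint edges) and $C$ is a vertex cover (contains an endpoint of every edge) obtained by choosing exactly one vertex from each edge of $M$. *)

theory Defs
  imports "HOL-Library.Nat_Bijection"
begin

section \<open>Computability on Baire space\<close>

type_synonym baire = "nat \<Rightarrow> nat"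

text \<open>
  Programs for unary partial functions on the natural numbers, relative to an oracle in Baire
  space. Several arguments are passed through the pairing function \<^const>\<open>prod_encode\<close>.
\<close>

datatype code =
    Zero | Succ | Left | Right | Oracle
  | Pair code code
  | Comp code code
  | Prec code code
  | Find code

primrec eval :: "code \<Rightarrow> baire \<Rightarrow> nat \<rightharpoonup> nat" where
  "eval Zero p = (\<lambda>n. Some 0)"
| "eval Succ p = (\<lambda>n. Some (Suc n))"
| "eval Left p = (\<lambda>n. Some (fst (prod_decode n)))"
| "eval Right p = (\<lambda>n. Some (snd (prod_decode n)))"
| "eval Oracle p = (\<lambda>n. Some (p n))"
| "eval (Pair c d) p =
     (\<lambda>n. case (eval c p n, eval d p n) of
            (Some a, Some b) \<Rightarrow> Some (prod_encode (a, b))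
          | _ \<Rightarrow> None)"
| "eval (Comp c d) p = (\<lambda>n. Option.bind (eval d p n) (eval c p))"
| "eval (Prec c d) p =
     (\<lambda>n. case prod_decode n of (a, m) \<Rightarrow>
        rec_nat (eval c p a)
          (\<lambda>k v. Option.bind v (\<lambda>r. eval d p (prod_encode (a, prod_encode (k, r))))) m)"
| "eval (Find c) p =
     (\<lambda>a. if \<exists>n. eval c p (prod_encode (a, n)) = Some 0
                 \<and> (\<forall>k<n. eval c p (prod_encode (a, k)) \<noteq> None)
           then Some (LEAST n. eval c p (prod_encode (a, n)) = Some 0)
           else None)"

text \<open>An effective Goedel numbering of the programs.\<close>

primrec encode :: "code \<Rightarrow> nat" where
  "encode Zero = 0"
| "encode Succ = 1"
| "encode Left = 2"
| "encode Right = 3"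
| "encode Oracle = 4"
| "encode (Pair c d) = 5 + 4 * prod_encode (encode c, encode d)"
| "encode (Comp c d) = 6 + 4 * prod_encode (encode c, encode d)"
| "encode (Prec c d) = 7 + 4 * prod_encode (encode c, encode d)"
| "encode (Find c) = 8 + 4 * encode c"

definition turing_reducible :: "baire \<Rightarrow> baire \<Rightarrow> bool" (infix "\<le>\<^sub>T" 50) where
  "r \<le>\<^sub>T p \<longleftrightarrow> (\<exists>c. \<forall>n. eval c p n = Some (r n))"

definition jump :: "baire \<Rightarrow> nat set" where
  "jump p = {encode c | c. eval c p (encode c) \<noteq> None}"

definition char_fun :: "nat set \<Rightarrow> baire" where
  "char_fun A = (\<lambda>n. if n \<in> A then 1 else 0)"

text \<open>
  A program witnessing computability may behave arbitrarily on oracles outside the domain.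
  Arithmetical means computable from a fixed finite iterate of the jump of the input.
\<close>

definition computable :: "(baire \<rightharpoonup> baire) \<Rightarrow> bool" where
  "computable F \<longleftrightarrow> (\<exists>c. \<forall>p r. F p = Some r \<longrightarrow> (\<forall>n. eval c p n = Some (r n)))"

definition arithmetical :: "(baire \<rightharpoonup> baire) \<Rightarrow> bool" where
  "arithmetical F \<longleftrightarrow>
     (\<exists>k c. \<forall>p r. F p = Some r \<longrightarrow>
        (\<forall>n. eval c (((\<lambda>s. char_fun (jump s)) ^^ k) p) n = Some (r n)))"

definition even_part :: "baire \<Rightarrow> baire" where
  "even_part p = (\<lambda>n. p (2 * n))"

definition odd_part :: "baire \<Rightarrow> baire" where
  "odd_part p = (\<lambda>n. p (2 * n + 1))"

definition join :: "baire \<Rightarrow> baire \<Rightarrow> baire" (infixr "\<oplus>" 65) where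
  "p \<oplus> q = (\<lambda>n. if even n then p (n div 2) else q (n div 2))"


section \<open>Problems and reducibilities\<close>

text \<open>
  A represented space is given by a partial map from Baire space; the underlying set is its range.
  A partial multivalued function is given by its value sets, and its domain consists of the points
  with nonempty value set.
\<close>

record ('x, 'y) problem =
  in_rep :: "baire \<rightharpoonup> 'x"
  out_rep :: "baire \<rightharpoonup> 'y"
  sols :: "'x \<Rightarrow> 'y set"

definition instances :: "('x, 'y) problem \<Rightarrow> 'x set" where
  "instances P = {x. sols P x \<noteq> {}}"

definition is_problem :: "('x, 'y) problem \<Rightarrow> bool" where
  "is_problem P \<longleftrightarrow>
     instances P \<subseteq> ran (in_rep P) \<and> (\<forall>x. sols P x \<subseteq> ran (out_rep P))"

definition names_instance :: "('x, 'y) problem \<Rightarrow> baire \<Rightarrow> 'x \<Rightarrow> bool" where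
  "names_instance P p x \<longleftrightarrow> in_rep P p = Some x \<and> x \<in> instances P"

definition names_solution :: "('x, 'y) problem \<Rightarrow> 'x \<Rightarrow> baire \<Rightarrow> bool" where
  "names_solution P x q \<longleftrightarrow> (\<exists>y. out_rep P q = Some y \<and> y \<in> sols P x)"

definition reducible_via ::
  "((baire \<rightharpoonup> baire) \<Rightarrow> bool) \<Rightarrow> ('x, 'y) problem \<Rightarrow> ('u, 'v) problem \<Rightarrow> bool" where
  "reducible_via \<F> P Q \<longleftrightarrow>
     (\<exists>\<Phi> \<Psi>. \<F> \<Phi> \<and> \<F> \<Psi> \<and>
        (\<forall>p x. names_instance P p x \<longrightarrow>
           (\<exists>p' u. \<Phi> p = Some p' \<and> names_instance Q p' u \<and>
              (\<forall>q. names_solution Q u q \<longrightarrow>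
                 (\<exists>r. \<Psi> (p \<oplus> q) = Some r \<and> names_solution P x r)))))"

definition weihrauch :: "('x, 'y) problem \<Rightarrow> ('u, 'v) problem \<Rightarrow> bool" (infix "\<le>\<^sub>W" 50) where
  "P \<le>\<^sub>W Q \<longleftrightarrow> reducible_via computable P Q"

definition arith_weihrauch ::
  "('x, 'y) problem \<Rightarrow> ('u, 'v) problem \<Rightarrow> bool" (infix "\<le>\<^sub>W\<^sup>a" 50) where
  "P \<le>\<^sub>W\<^sup>a Q \<longleftrightarrow> reducible_via arithmetical P Q"

definition comp_reducible ::
  "('x, 'y) problem \<Rightarrow> ('u, 'v) problem \<Rightarrow> bool" (infix "\<le>\<^sub>c" 50) where
  "P \<le>\<^sub>c Q \<longleftrightarrow>
     (\<forall>p x. names_instance P p x \<longrightarrow>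
        (\<exists>p' u. p' \<le>\<^sub>T p \<and> names_instance Q p' u \<and>
           (\<forall>q. names_solution Q u q \<longrightarrow>
              (\<exists>r. r \<le>\<^sub>T p \<oplus> q \<and> names_solution P x r))))"

definition composition :: "('y, 'z) problem \<Rightarrow> ('x, 'y) problem \<Rightarrow> ('x, 'z) problem" where
  "composition Q P =
     \<lparr>in_rep = in_rep P, out_rep = out_rep Q,
      sols = (\<lambda>x. if sols P x \<subseteq> instances Q then (\<Union>y\<in>sols P x. sols Q y) else {})\<rparr>"

text \<open>
  For the compositional product it suffices to let problems range over represented spaces whose
  underlying set is a subset of Baire space, with an arbitrary representation: every represented
  space is isomorphic to one of these, by choosing a name for each point.
\<close>

definition comp_upper_bound ::
  "('u, 'v) problem \<Rightarrow> ('x, 'y) problem \<Rightarrow> (baire, baire) problem \<Rightarrow> bool" where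
  "comp_upper_bound Q P S \<longleftrightarrow>
     (\<forall>(Q0 :: (baire, baire) problem) (P0 :: (baire, baire) problem).
        is_problem Q0 \<and> is_problem P0 \<and> in_rep Q0 = out_rep P0 \<and> Q0 \<le>\<^sub>W Q \<and> P0 \<le>\<^sub>W P
        \<longrightarrow> composition Q0 P0 \<le>\<^sub>W S)"

definition is_comp_product ::
  "('u, 'v) problem \<Rightarrow> ('x, 'y) problem \<Rightarrow> (baire, baire) problem \<Rightarrow> bool" where
  "is_comp_product Q P S \<longleftrightarrow>
     is_problem S \<and> comp_upper_bound Q P S \<and>
     (\<forall>T. is_problem T \<and> comp_upper_bound Q P T \<longrightarrow> S \<le>\<^sub>W T)"

text \<open>A representative of the degree \<open>Q * P\<close>, which is unique up to Weihrauch equivalence.\<close>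

definition comp_product ::
  "('u, 'v) problem \<Rightarrow> ('x, 'y) problem \<Rightarrow> (baire, baire) problem" (infixr "\<^bold>*" 70) where
  "Q \<^bold>* P = (SOME S. is_comp_product Q P S)"


section \<open>Representations\<close>

definition nat_rep :: "baire \<rightharpoonup> nat" where
  "nat_rep p = Some (p 0)"

definition set_rep :: "baire \<rightharpoonup> nat set" where
  "set_rep p = (if \<exists>A. p = char_fun A then Some {n. p n = 1} else None)"

definition rel_rep :: "baire \<rightharpoonup> (nat \<times> nat) set" where
  "rel_rep p = map_option (\<lambda>A. {(a, b). prod_encode (a, b) \<in> A}) (set_rep p)"

definition family_rep :: "baire \<rightharpoonup> (nat \<Rightarrow> nat set)" where
  "family_rep p = map_option (\<lambda>R a. {n. (a, n) \<in> R}) (rel_rep p)"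

text \<open>
  A set of undirected edges is represented by the corresponding symmetric irreflexive relation.
\<close>

definition edges_rep :: "baire \<rightharpoonup> nat set set" where
  "edges_rep p =
     (case rel_rep p of
        None \<Rightarrow> None
      | Some R \<Rightarrow> if sym R \<and> irrefl R then Some {{a, b} | a b. (a, b) \<in> R} else None)"

definition prod_rep :: "(baire \<rightharpoonup> 'a) \<Rightarrow> (baire \<rightharpoonup> 'b) \<Rightarrow> baire \<rightharpoonup> 'a \<times> 'b" where
  "prod_rep \<delta> \<epsilon> p =
     (case (\<delta> (even_part p), \<epsilon> (odd_part p)) of
        (Some a, Some b) \<Rightarrow> Some (a, b)
      | _ \<Rightarrow> None)"


section \<open>The problems\<close>

definition LPO :: "(baire, nat) problem" where
  "LPO =
     \<lparr>in_rep = Some, out_rep = nat_rep,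
      sols = (\<lambda>p. {if \<exists>k. p k = 0 then 1 else 0})\<rparr>"

text \<open>
  A family indexed by the field of \<open>L\<close> is a total function with value \<open>{}\<close> outside the field.
  An ordering without first element has no jump hierarchy.
\<close>

definition jump_hierarchy :: "(nat \<times> nat) set \<Rightarrow> nat set \<Rightarrow> (nat \<Rightarrow> nat set) \<Rightarrow> bool" where
  "jump_hierarchy L A X \<longleftrightarrow>
     (\<exists>z\<in>Field L. (\<forall>a\<in>Field L. (z, a) \<in> L) \<and> X z = A \<and>
        (\<forall>b\<in>Field L. b \<noteq> z \<longrightarrow>
           X b = jump (char_fun {prod_encode (a, n) | a n. (a, b) \<in> L \<and> a \<noteq> b \<and> n \<in> X a})))
     \<and> (\<forall>a. a \<notin> Field L \<longrightarrow> X a = {})"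

definition descending :: "(nat \<times> nat) set \<Rightarrow> (nat \<Rightarrow> nat) \<Rightarrow> bool" where
  "descending L s \<longleftrightarrow> (\<forall>n. (s (Suc n), s n) \<in> L \<and> s (Suc n) \<noteq> s n)"

datatype atr_solution = Descending "nat \<Rightarrow> nat" | Hierarchy "nat \<Rightarrow> nat set"

definition atr_solution_rep :: "baire \<rightharpoonup> atr_solution" where
  "atr_solution_rep p =
     (if p 0 = 0 then Some (Descending (\<lambda>n. p (Suc n)))
      else if p 0 = 1 then map_option Hierarchy (family_rep (\<lambda>n. p (Suc n)))
      else None)"

definition ATR2 :: "((nat \<times> nat) set \<times> nat set, atr_solution) problem" where
  "ATR2 =
     \<lparr>in_rep = prod_rep rel_rep set_rep, out_rep = atr_solution_rep,
      sols = (\<lambda>(L, A). if Linear_order L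
                then {Descending s | s. descending L s} \<union> {Hierarchy X | X. jump_hierarchy L A X}
                else {})\<rparr>"

definition bipartite_graph :: "nat set \<Rightarrow> nat set set \<Rightarrow> bool" where
  "bipartite_graph V E \<longleftrightarrow>
     (\<exists>A B. A \<union> B = V \<and> A \<inter> B = {} \<and> (\<forall>e\<in>E. \<exists>a\<in>A. \<exists>b\<in>B. e = {a, b}))"

definition konig_cover :: "nat set set \<Rightarrow> nat set \<Rightarrow> nat set set \<Rightarrow> bool" where
  "konig_cover E C M \<longleftrightarrow>
     M \<subseteq> E \<and> pairwise disjnt M \<and>
     (\<forall>e\<in>E. e \<inter> C \<noteq> {}) \<and>
     (\<exists>f. (\<forall>e\<in>M. f e \<in> e) \<and> C = f ` M)"

definition KDT :: "(nat set \<times> nat set set, nat set \<times> nat set set) problem" where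
  "KDT =
     \<lparr>in_rep = prod_rep set_rep edges_rep, out_rep = prod_rep set_rep edges_rep,
      sols = (\<lambda>(V, E). if bipartite_graph V E then {(C, M). konig_cover E C M} else {})\<rparr>"

end

theory Submission
  imports Defs
begin

text \<open>
  Both problems are compared with a game. For a decidable relation \<open>D\<close> on the natural numbers
  consider the forest of its finite paths, in which every child occurs infinitely often. In a
  Koenig cover \<open>(C, M)\<close> of this forest, a node that is matched with its parent and covers that edge
  is useless, but of two copies of a child at most one can be so. Hence for all other nodes,
  membership in \<open>C\<close> behaves like the truth value of ``the player to move wins''. If two copies of
  the same position get different values, the disagreement propagates to a pair of children, and
  iterating this computes an infinite \<open>D\<close>-path. Otherwise the values at the roots form a kernel
  of \<open>D\<close>. For a suitable \<open>D\<close> computable from \<open>L\<close> and \<open>A\<close>, a kernel is a jump hierarchy, because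
  membership in a jump is witnessed by a finite derivation that asks finitely many oracle
  questions, and an infinite path descends in \<open>L\<close>. Whether some disagreement occurs is a single
  question to \<open>LPO\<close>.

  The forest has a Koenig cover by the usual analysis of open games. That the compositional product
  exists follows from a universal program, which is obtained from the same derivations.
\<close>

section \<open>Total recursive functionals\<close>

text \<open>The obstacle is that a cover need not give equal values to copies of one position: in an
  infinite play a position may be undecided, and then nothing forces its copies to agree. So a
  disagreement must itself yield a solution, and it does because every infinite play descends in
  \<open>L\<close>. The second constraint is that the moves be decidable in \<open>p\<close>,
  although the stages of the hierarchy are not. A derivation put forward therefore carries guessed
  oracle answers, and the opponent contests one guess, which concerns an earlier stage. A kernel
  only has to satisfy a local equation, so \<open>L\<close> may be ill-founded. An ordering without
  first element has no jump hierarchy even if the values form a kernel. A separate position asks for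
  a first element, and if the cover denies it, smaller and smaller elements can be read off. Both
  kinds of failure are existential in the instance and the cover, hence fit into one
  question.\<close>

abbreviation pr1 :: "nat \<Rightarrow> nat" where "pr1 n \<equiv> fst (prod_decode n)"
abbreviation pr2 :: "nat \<Rightarrow> nat" where "pr2 n \<equiv> snd (prod_decode n)"

definition computes :: "code \<Rightarrow> baire \<Rightarrow> baire \<Rightarrow> bool" where
  "computes c p r \<longleftrightarrow> (\<forall>n. eval c p n = Some (r n))"

text \<open>Totality on every oracle keeps the closure rules free of definedness conditions.
  Programs that may diverge arise separately, from unbounded search.\<close>

definition recursive :: "(baire \<Rightarrow> nat \<Rightarrow> nat) \<Rightarrow> bool" where
  "recursive f \<longleftrightarrow> (\<exists>c. \<forall>p. computes c p (f p))"

definition decidable :: "(baire \<Rightarrow> nat \<Rightarrow> bool) \<Rightarrow> bool" where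
  "decidable P \<longleftrightarrow> recursive (\<lambda>p n. of_bool (P p n))"

lemma recursiveI: "(\<And>p n. eval c p n = Some (f p n)) \<Longrightarrow> recursive f"
  by (auto simp: recursive_def computes_def)

named_theorems rec_intros

lemma recursive_id [rec_intros]: "recursive (\<lambda>p n. n)"
  by (rule recursiveI[of "Pair Left Right"]) simp

lemma recursive_const [rec_intros]: "recursive (\<lambda>p n. k)"
proof (induction k)
  case 0
  show ?case by (rule recursiveI[of Zero]) simp
next
  case (Suc k)
  then obtain c where "\<And>p n. eval c p n = Some k"
    unfolding recursive_def computes_def by blast
  then show ?case by (intro recursiveI[of "Comp Succ c"]) simp
qed

lemma recursive_comp:
  assumes "recursive g" "recursive f"
  shows "recursive (\<lambda>p n. g p (f p n))"
proof -
  obtain c d where "\<And>p n. eval c p n = Some (g p n)" "\<And>p n. eval d p n = Some (f p n)"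
    using assms unfolding recursive_def computes_def by blast
  then show ?thesis by (intro recursiveI[of "Comp c d"]) simp
qed

lemma recursive_oracle [rec_intros]: "recursive f \<Longrightarrow> recursive (\<lambda>p n. p (f p n))"
  by (rule recursive_comp[of "\<lambda>p. p"]) (rule recursiveI[of Oracle], simp)

lemma recursive_Suc [rec_intros]: "recursive f \<Longrightarrow> recursive (\<lambda>p n. Suc (f p n))"
  by (rule recursive_comp[of "\<lambda>p. Suc"]) (rule recursiveI[of Succ], simp)

lemma recursive_pr1 [rec_intros]: "recursive f \<Longrightarrow> recursive (\<lambda>p n. pr1 (f p n))"
  by (rule recursive_comp[of "\<lambda>p. pr1"]) (rule recursiveI[of Left], simp)

lemma recursive_pr2 [rec_intros]: "recursive f \<Longrightarrow> recursive (\<lambda>p n. pr2 (f p n))"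
  by (rule recursive_comp[of "\<lambda>p. pr2"]) (rule recursiveI[of Right], simp)

lemma recursive_prod_encode [rec_intros]:
  assumes "recursive f" "recursive g"
  shows "recursive (\<lambda>p n. prod_encode (f p n, g p n))"
proof -
  obtain c d where "\<And>p n. eval c p n = Some (f p n)" "\<And>p n. eval d p n = Some (g p n)"
    using assms unfolding recursive_def computes_def by blast
  then show ?thesis by (intro recursiveI[of "Pair c d"]) simp
qed

lemma recursive_comp2:
  assumes "recursive (\<lambda>p m. h p (pr1 m) (pr2 m))" "recursive f" "recursive g"
  shows "recursive (\<lambda>p n. h p (f p n) (g p n))"
  using recursive_comp[OF assms(1) recursive_prod_encode[OF assms(2,3)]] by simp

text \<open>The argument \<open>n\<close> is itself the parameter handed to \<open>Prec\<close>,
  which is why base, step and length may all depend on it.\<close>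

lemma recursive_rec_nat:
  assumes "recursive g" "recursive (\<lambda>p m. h p (pr1 m) (pr1 (pr2 m)) (pr2 (pr2 m)))" "recursive b"
  shows "recursive (\<lambda>p n. rec_nat (g p n) (h p n) (b p n))"
proof -
  obtain c where c: "\<And>p n. eval c p n = Some (g p n)" using assms(1) unfolding recursive_def computes_def by blast
  obtain d where d: "\<And>p m. eval d p m = Some (h p (pr1 m) (pr1 (pr2 m)) (pr2 (pr2 m)))"
    using assms(2) unfolding recursive_def computes_def by blast
  have "rec_nat (eval c p a)
          (\<lambda>k v. Option.bind v (\<lambda>r. eval d p (prod_encode (a, prod_encode (k, r))))) m
        = Some (rec_nat (g p a) (h p a) m)" for p a m
    by (induction m) (simp_all add: c d)
  then have "recursive (\<lambda>p m. rec_nat (g p (pr1 m)) (h p (pr1 m)) (pr2 m))"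
    by (intro recursiveI[of "Prec c d"]) (simp add: case_prod_beta)
  from recursive_comp2[OF this recursive_id assms(3)] show ?thesis .
qed

lemma recursive_add [rec_intros]:
  assumes "recursive f" "recursive g"
  shows "recursive (\<lambda>p n. f p n + g p n)"
proof -
  have "rec_nat a (\<lambda>_ r. Suc r) b = a + b" for a b :: nat by (induction b) auto
  moreover have "recursive (\<lambda>p n. rec_nat (f p n) (\<lambda>_ r. Suc r) (g p n))"
    by (intro recursive_rec_nat rec_intros assms)
  ultimately show ?thesis by simp
qed

lemma recursive_mult [rec_intros]:
  assumes "recursive f" "recursive g"
  shows "recursive (\<lambda>p n. f p n * g p n)"
proof -
  have "rec_nat 0 (\<lambda>_ r. r + a) b = a * b" for a b :: nat by (induction b) auto
  moreover have "recursive (\<lambda>p n. rec_nat 0 (\<lambda>_ r. r + f p n) (g p n))"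
    by (intro recursive_rec_nat rec_intros recursive_comp[OF assms(1)] assms)
  ultimately show ?thesis by simp
qed

lemma recursive_pred [rec_intros]:
  assumes "recursive f"
  shows "recursive (\<lambda>p n. f p n - 1)"
proof -
  have "rec_nat 0 (\<lambda>k _. k) b = b - 1" for b :: nat by (cases b) auto
  moreover have "recursive (\<lambda>p n. rec_nat 0 (\<lambda>k _. k) (f p n))"
    by (intro recursive_rec_nat rec_intros assms)
  ultimately show ?thesis by simp
qed

lemma recursive_diff [rec_intros]:
  assumes "recursive f" "recursive g"
  shows "recursive (\<lambda>p n. f p n - g p n)"
proof -
  have "rec_nat a (\<lambda>_ r. r - 1) b = a - b" for a b :: nat by (induction b) auto
  moreover have "recursive (\<lambda>p n. rec_nat (f p n) (\<lambda>_ r. r - 1) (g p n))"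
    by (intro recursive_rec_nat rec_intros assms)
  ultimately show ?thesis by simp
qed

lemma recursive_if [rec_intros]:
  assumes "decidable P" "recursive f" "recursive g"
  shows "recursive (\<lambda>p n. if P p n then f p n else g p n)"
proof -
  \<comment> \<open>A case distinction is a recursion of length 0 or 1.\<close>
  have "rec_nat (g p n) (\<lambda>_ _. f p n) (of_bool (P p n)) = (if P p n then f p n else g p n)" for p n
    by simp
  moreover have "recursive (\<lambda>p n. rec_nat (g p n) (\<lambda>_ _. f p n) (of_bool (P p n)))"
    by (intro recursive_rec_nat rec_intros recursive_comp[OF assms(2)] assms
        assms(1)[unfolded decidable_def])
  ultimately show ?thesis by simp
qed

lemma decidable_comp:
  "decidable P \<Longrightarrow> recursive f \<Longrightarrow> decidable (\<lambda>p n. P p (f p n))"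
  unfolding decidable_def by (rule recursive_comp)

lemma decidable_comp2:
  assumes "decidable (\<lambda>p m. P p (pr1 m) (pr2 m))" "recursive f" "recursive g"
  shows "decidable (\<lambda>p n. P p (f p n) (g p n))"
  using assms unfolding decidable_def by (rule recursive_comp2)

lemma decidable_not [rec_intros]:
  assumes "decidable P"
  shows "decidable (\<lambda>p n. \<not> P p n)"
proof -
  have "of_bool (\<not> P p n) = (if P p n then 0 else 1 :: nat)" for p n by simp
  then show ?thesis
    unfolding decidable_def by (simp only:) (intro rec_intros assms)
qed

lemma decidable_conj [rec_intros]:
  assumes "decidable P" "decidable Q"
  shows "decidable (\<lambda>p n. P p n \<and> Q p n)"
proof -
  have "of_bool (P p n \<and> Q p n) = (if P p n then of_bool (Q p n) else 0 :: nat)" for p n by simp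
  then show ?thesis
    unfolding decidable_def
    by (simp only:) (intro rec_intros assms assms(2)[unfolded decidable_def])
qed

lemma decidable_disj [rec_intros]:
  assumes "decidable P" "decidable Q"
  shows "decidable (\<lambda>p n. P p n \<or> Q p n)"
proof -
  have "decidable (\<lambda>p n. \<not> (\<not> P p n \<and> \<not> Q p n))"
    by (intro rec_intros assms)
  then show ?thesis by simp
qed

lemma decidable_imp [rec_intros]:
  assumes "decidable P" "decidable Q"
  shows "decidable (\<lambda>p n. P p n \<longrightarrow> Q p n)"
  unfolding imp_conv_disj by (intro decidable_disj decidable_not assms)

lemma decidable_eq [rec_intros]:
  assumes "recursive f" "recursive g"
  shows "decidable (\<lambda>p n. f p n = g p n)"
proof -
  \<comment> \<open>Truncated subtraction: both differences vanish exactly when the values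
    agree.\<close>
  have "of_bool (f p n = g p n) = 1 - ((f p n - g p n) + (g p n - f p n))" for p n
    by simp
  then show ?thesis
    unfolding decidable_def by (simp only:) (intro rec_intros assms)
qed

lemma decidable_bex [rec_intros]:
  assumes "decidable (\<lambda>p m. P p (pr1 m) (pr2 m))" "recursive b"
  shows "decidable (\<lambda>p n. \<exists>k<b p n. P p n k)"
proof -
  have "of_bool (\<exists>k<b. Q k) = rec_nat 0 (\<lambda>k r. if Q k then 1 else r :: nat) b"
    for b and Q :: "nat \<Rightarrow> bool"
  proof (induction b)
    case (Suc b)
    have "rec_nat 0 (\<lambda>k r. if Q k then 1 else r :: nat) (Suc b) =
        (if Q b then 1 else of_bool (\<exists>k<b. Q k) :: nat)"
      unfolding Suc by simp
    also have "\<dots> = of_bool (\<exists>k<Suc b. Q k)" by (auto simp: less_Suc_eq)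
    finally show ?case ..
  qed simp
  moreover have "recursive (\<lambda>p n. rec_nat 0 (\<lambda>k r. if P p n k then 1 else r) (b p n))"
    by (intro recursive_rec_nat rec_intros decidable_comp2[where P = P, OF assms(1)] assms(2))
  ultimately show ?thesis unfolding decidable_def by simp
qed

lemma decidable_ball [rec_intros]:
  assumes "decidable (\<lambda>p m. P p (pr1 m) (pr2 m))" "recursive b"
  shows "decidable (\<lambda>p n. \<forall>k<b p n. P p n k)"
proof -
  have "decidable (\<lambda>p n. \<not> (\<exists>k<b p n. \<not> P p n k))"
    by (intro rec_intros assms)
  then show ?thesis by simp
qed

text \<open>\<open>Find\<close> looks for a zero, hence the negated test. As the test is total,
  \<open>Find\<close> diverges only if there is no witness.\<close>

lemma search_code:
  assumes "decidable (\<lambda>p m. P p (pr1 m) (pr2 m))"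
  shows "\<exists>c. \<forall>p n. eval c p n = (if \<exists>k. P p n k then Some (LEAST k. P p n k) else None)"
proof -
  have "recursive (\<lambda>p m. of_bool (\<not> P p (pr1 m) (pr2 m)))"
    using decidable_not[OF assms] unfolding decidable_def .
  then obtain c where c: "\<And>p m. eval c p m = Some (of_bool (\<not> P p (pr1 m) (pr2 m)))"
    unfolding recursive_def computes_def by blast
  show ?thesis by (rule exI[of _ "Find c"]) (simp add: c)
qed

text \<open>Syntactic counterpart of composing functionals on Baire space: each oracle query is
  answered by running \<open>d\<close>.\<close>

primrec subst :: "code \<Rightarrow> code \<Rightarrow> code" where
  "subst d Zero = Zero"
| "subst d Succ = Succ"
| "subst d Left = Left"
| "subst d Right = Right"
| "subst d Oracle = d"
| "subst d (Pair c c') = Pair (subst d c) (subst d c')"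
| "subst d (Comp c c') = Comp (subst d c) (subst d c')"
| "subst d (Prec c c') = Prec (subst d c) (subst d c')"
| "subst d (Find c) = Find (subst d c)"

lemma eval_subst: "computes d p r \<Longrightarrow> eval (subst d c) p = eval c r"
  by (induction c) (auto simp: computes_def)

lemma computes_subst: "computes d p r \<Longrightarrow> computes c r s \<Longrightarrow> computes (subst d c) p s"
  unfolding computes_def[of "subst d c"] by (simp add: eval_subst) (simp add: computes_def)

lemma even_part_join [simp]: "even_part (p \<oplus> q) = p"
  and odd_part_join [simp]: "odd_part (p \<oplus> q) = q"
  by (simp_all add: even_part_def odd_part_def join_def)

lemma decidable_even: "decidable (\<lambda>p n. even n)"
proof -
  have "even n \<longleftrightarrow> (\<exists>k<Suc n. n = 2 * k)" for n :: nat
    by (auto elim!: evenE)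
  then show ?thesis by (simp only:) (intro rec_intros)
qed

lemma recursive_half: "recursive (\<lambda>p n. n div 2)"
proof -
  have "n div 2 = rec_nat 0 (\<lambda>k r. if even k then r else Suc r) n" for n :: nat
    by (induction n) auto
  then show ?thesis
    by (simp only:) (intro recursive_rec_nat rec_intros decidable_comp[OF decidable_even])
qed

lemma recursive_join:
  assumes "recursive f" "recursive g"
  shows "recursive (\<lambda>p. f p \<oplus> g p)"
  unfolding join_def
  by (intro rec_intros decidable_even recursive_comp[OF assms(1)] recursive_comp[OF assms(2)]
      recursive_half)

section \<open>Derivations of halting computations\<close>

lemma encode_surj: "\<exists>c. encode c = n"
proof (induction n rule: less_induct)
  case (less n)
  have ex2: "\<exists>c d. k = prod_encode (encode c, encode d)" if "k < n" for k
  proof -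
    obtain a b where k: "k = prod_encode (a, b)" by (metis prod_decode_inverse surj_pair)
    have "a < n" "b < n" using that le_prod_encode_1[of a b] le_prod_encode_2[of b a] k by auto
    then show ?thesis using less k by metis
  qed
  consider "n = 0" | "n = 1" | "n = 2" | "n = 3" | "n = 4"
    | k where "n = 5 + 4 * k" | k where "n = 6 + 4 * k" | k where "n = 7 + 4 * k"
    | k where "n = 8 + 4 * k"
  proof -
    have "n = 0 \<or> n = 1 \<or> n = 2 \<or> n = 3 \<or> n = 4 \<or> (\<exists>k. n = 5 + 4 * k) \<or>
        (\<exists>k. n = 6 + 4 * k) \<or> (\<exists>k. n = 7 + 4 * k) \<or> (\<exists>k. n = 8 + 4 * k)"
      by presburger
    then show ?thesis using that by blast
  qed
  then show ?case
  proof cases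
    case 6
    then obtain c d where "k = prod_encode (encode c, encode d)" using ex2[of k] by auto
    with 6 show ?thesis by (intro exI[of _ "Pair c d"]) simp
  next
    case 7
    then obtain c d where "k = prod_encode (encode c, encode d)" using ex2[of k] by auto
    with 7 show ?thesis by (intro exI[of _ "Comp c d"]) simp
  next
    case 8
    then obtain c d where "k = prod_encode (encode c, encode d)" using ex2[of k] by auto
    with 8 show ?thesis by (intro exI[of _ "Prec c d"]) simp
  next
    case 9
    then obtain c where "k = encode c" using less[of k] by auto
    with 9 show ?thesis by (intro exI[of _ "Find c"]) simp
  qed (metis encode.simps)+
qed

text \<open>Residues modulo 4 separate the compound constructors, whatever the codes of their
  parts.\<close>

lemma mod4_eq:
  fixes a b :: nat
  shows "5 + 4 * a \<noteq> 6 + 4 * b" "5 + 4 * a \<noteq> 7 + 4 * b" "5 + 4 * a \<noteq> 8 + 4 * b"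
    "6 + 4 * a \<noteq> 7 + 4 * b" "6 + 4 * a \<noteq> 8 + 4 * b" "7 + 4 * a \<noteq> 8 + 4 * b"
  by presburger+
lemma encode_eq_Pair:
  assumes "encode d = 5 + 4 * k"
  shows "\<exists>d1 d2. d = Pair d1 d2 \<and> k = prod_encode (encode d1, encode d2)"
proof (cases d)
  case (Comp a b)
  then show ?thesis using assms mod4_eq(1)[of k "prod_encode (encode a, encode b)"] by simp
next
  case (Prec a b)
  then show ?thesis using assms mod4_eq(2)[of k "prod_encode (encode a, encode b)"] by simp
next
  case (Find a)
  then show ?thesis using assms mod4_eq(3)[of k "encode a"] by simp
qed (use assms in simp_all)

lemma encode_eq_Comp:
  assumes "encode d = 6 + 4 * k"
  shows "\<exists>d1 d2. d = Comp d1 d2 \<and> k = prod_encode (encode d1, encode d2)"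
proof (cases d)
  case (Pair a b)
  then show ?thesis using assms mod4_eq(1)[of "prod_encode (encode a, encode b)" k] by simp
next
  case (Prec a b)
  then show ?thesis using assms mod4_eq(4)[of k "prod_encode (encode a, encode b)"] by simp
next
  case (Find a)
  then show ?thesis using assms mod4_eq(5)[of k "encode a"] by simp
qed (use assms in simp_all)

lemma encode_eq_Prec:
  assumes "encode d = 7 + 4 * k"
  shows "\<exists>d1 d2. d = Prec d1 d2 \<and> k = prod_encode (encode d1, encode d2)"
proof (cases d)
  case (Pair a b)
  then show ?thesis using assms mod4_eq(2)[of "prod_encode (encode a, encode b)" k] by simp
next
  case (Comp a b)
  then show ?thesis using assms mod4_eq(4)[of "prod_encode (encode a, encode b)" k] by simp
next
  case (Find a)
  then show ?thesis using assms mod4_eq(6)[of k "encode a"] by simp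
qed (use assms in simp_all)

lemma encode_eq_Find:
  assumes "encode d = 8 + 4 * k"
  shows "\<exists>d1. d = Find d1 \<and> k = encode d1"
proof (cases d)
  case (Pair a b)
  then show ?thesis using assms mod4_eq(3)[of "prod_encode (encode a, encode b)" k] by simp
next
  case (Comp a b)
  then show ?thesis using assms mod4_eq(5)[of "prod_encode (encode a, encode b)" k] by simp
next
  case (Prec a b)
  then show ?thesis using assms mod4_eq(6)[of "prod_encode (encode a, encode b)" k] by simp
qed (use assms in simp_all)

lemma encode_inj: "encode c = encode d \<Longrightarrow> c = d"
proof (induction c arbitrary: d)
  case (Pair c1 c2)
  from encode_eq_Pair[OF Pair.prems[symmetric, unfolded encode.simps]]
  show ?case using Pair.IH by (metis prod.inject prod_encode_eq)
next
  case (Comp c1 c2)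
  from encode_eq_Comp[OF Comp.prems[symmetric, unfolded encode.simps]]
  show ?case using Comp.IH by (metis prod.inject prod_encode_eq)
next
  case (Prec c1 c2)
  from encode_eq_Prec[OF Prec.prems[symmetric, unfolded encode.simps]]
  show ?case using Prec.IH by (metis prod.inject prod_encode_eq)
next
  case (Find c)
  from encode_eq_Find[OF Find.prems[symmetric, unfolded encode.simps]]
  show ?case using Find.IH by metis
next
  case Zero then show ?case by (cases d) auto
next
  case Succ then show ?case by (cases d) auto
next
  case Left then show ?case by (cases d) auto
next
  case Right then show ?case by (cases d) auto
next
  case Oracle then show ?case by (cases d) auto
qed

section \<open>Derivations and their soundness\<close>

abbreviation prog :: "nat \<Rightarrow> nat" where "prog t \<equiv> pr1 t"
abbreviation inp :: "nat \<Rightarrow> nat" where "inp t \<equiv> pr1 (pr2 t)"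
abbreviation outp :: "nat \<Rightarrow> nat" where "outp t \<equiv> pr2 (pr2 t)"

text \<open>One kind of clause per constructor, for triples (program, input, output) with premises
  in \<open>S\<close>. Any answer to an oracle query is accepted, so the notion is independent of
  the oracle; correctness of the answers is the separate condition \<open>agrees\<close>. The part
  of a recursion that a clause does not evaluate is only a number below \<open>prog t\<close>, which
  keeps everything decidable.\<close>

definition justified :: "nat set \<Rightarrow> nat \<Rightarrow> bool" where
  "justified S t \<longleftrightarrow>
     prog t = 0 \<and> outp t = 0 \<or>
     prog t = 1 \<and> outp t = Suc (inp t) \<or>
     prog t = 2 \<and> outp t = pr1 (inp t) \<or>
     prog t = 3 \<and> outp t = pr2 (inp t) \<or>
     prog t = 4 \<or>
     (\<exists>u\<in>S. \<exists>v\<in>S. prog t = 5 + 4 * prod_encode (prog u, prog v) \<and>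
        inp u = inp t \<and> inp v = inp t \<and> outp t = prod_encode (outp u, outp v)) \<or>
     (\<exists>u\<in>S. \<exists>v\<in>S. prog t = 6 + 4 * prod_encode (prog u, prog v) \<and>
        inp v = inp t \<and> inp u = outp v \<and> outp t = outp u) \<or>
     (\<exists>u\<in>S. \<exists>d<prog t. prog t = 7 + 4 * prod_encode (prog u, d) \<and>
        inp t = prod_encode (inp u, 0) \<and> outp t = outp u) \<or>
     (\<exists>u\<in>S. \<exists>v\<in>S. \<exists>c<prog t. prog t = 7 + 4 * prod_encode (c, prog v) \<and> prog u = prog t \<and>
        inp t = prod_encode (pr1 (inp u), Suc (pr2 (inp u))) \<and>
        inp v = prod_encode (pr1 (inp u), prod_encode (pr2 (inp u), outp u)) \<and>
        outp t = outp v) \<or>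
     (\<exists>u\<in>S. prog t = 8 + 4 * prog u \<and> inp u = prod_encode (inp t, outp t) \<and> outp u = 0 \<and>
        (\<forall>k<outp t. \<exists>v\<in>S. prog v = prog u \<and> inp v = prod_encode (inp t, k) \<and> outp v \<noteq> 0))"

text \<open>
  A number \<open>w\<close> codes the list of length \<^term>\<open>pr1 w\<close> whose members are read off \<^term>\<open>pr2 w\<close>
  by iterating the projections.
\<close>

definition entry :: "nat \<Rightarrow> nat \<Rightarrow> nat" where
  "entry w i = pr1 (rec_nat (pr2 w) (\<lambda>_ r. pr2 r) i)"

definition entries :: "nat \<Rightarrow> nat set" where
  "entries w = entry w ` {..<pr1 w}"

definition derivation :: "nat \<Rightarrow> bool" where
  "derivation w \<longleftrightarrow> (\<forall>i<pr1 w. justified (entry w ` {..<i}) (entry w i))"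

definition agrees :: "nat \<Rightarrow> baire \<Rightarrow> bool" where
  "agrees w q \<longleftrightarrow> (\<forall>t\<in>entries w. prog t = 4 \<longrightarrow> outp t = q (inp t))"

lemma justified_mono: "justified S t \<Longrightarrow> S \<subseteq> S' \<Longrightarrow> justified S' t"
  unfolding justified_def
  by (elim disj_forward; (assumption | blast))

lemma justified_sound:
  assumes "justified S t" and "prog t = 4 \<Longrightarrow> outp t = q (inp t)"
    and S: "\<And>u. u \<in> S \<Longrightarrow> \<exists>c. prog u = encode c \<and> eval c q (inp u) = Some (outp u)"
  shows "\<exists>c. prog t = encode c \<and> eval c q (inp t) = Some (outp t)"
  using assms(1) unfolding justified_def
proof (elim disjE bexE exE conjE)
  assume "prog t = 0" "outp t = 0"
  then show ?thesis by (intro exI[of _ Zero]) simp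
next
  assume "prog t = 1" "outp t = Suc (inp t)"
  then show ?thesis by (intro exI[of _ Succ]) simp
next
  assume "prog t = 2" "outp t = pr1 (inp t)"
  then show ?thesis by (intro exI[of _ Left]) simp
next
  assume "prog t = 3" "outp t = pr2 (inp t)"
  then show ?thesis by (intro exI[of _ Right]) simp
next
  assume "prog t = 4"
  then show ?thesis using assms(2) by (intro exI[of _ Oracle]) simp
next
  fix u v
  assume *: "u \<in> S" "v \<in> S" "prog t = 5 + 4 * prod_encode (prog u, prog v)"
    "inp u = inp t" "inp v = inp t" "outp t = prod_encode (outp u, outp v)"
  obtain c d where "prog u = encode c" "eval c q (inp u) = Some (outp u)"
    "prog v = encode d" "eval d q (inp v) = Some (outp v)" using S *(1,2) by metis
  with * show ?thesis by (intro exI[of _ "Pair c d"]) simp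
next
  fix u v
  assume *: "u \<in> S" "v \<in> S" "prog t = 6 + 4 * prod_encode (prog u, prog v)"
    "inp v = inp t" "inp u = outp v" "outp t = outp u"
  obtain c d where "prog u = encode c" "eval c q (inp u) = Some (outp u)"
    "prog v = encode d" "eval d q (inp v) = Some (outp v)" using S *(1,2) by metis
  with * show ?thesis by (intro exI[of _ "Comp c d"]) simp
next
  fix u n
  assume *: "u \<in> S" "prog t = 7 + 4 * prod_encode (prog u, n)"
    "inp t = prod_encode (inp u, 0)" "outp t = outp u"
  obtain c where "prog u = encode c" "eval c q (inp u) = Some (outp u)" using S *(1) by metis
  \<comment> \<open>The step program is not run here, so that \<open>n\<close> is the code of a
    program rests on surjectivity of the numbering.\<close>
  moreover obtain d where "n = encode d" using encode_surj by metis
  ultimately show ?thesis using * by (intro exI[of _ "Prec c d"]) simp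
next
  fix u v n
  assume *: "u \<in> S" "v \<in> S" "prog t = 7 + 4 * prod_encode (n, prog v)" "prog u = prog t"
    "inp t = prod_encode (pr1 (inp u), Suc (pr2 (inp u)))"
    "inp v = prod_encode (pr1 (inp u), prod_encode (pr2 (inp u), outp u))" "outp t = outp v"
  obtain c d where cd: "prog u = encode c" "eval c q (inp u) = Some (outp u)"
    "prog v = encode d" "eval d q (inp v) = Some (outp v)" using S *(1,2) by metis
  then have "encode c = 7 + 4 * prod_encode (n, encode d)" using * by simp
  from encode_eq_Prec[OF this] obtain c' where "c = Prec c' d"
    by (metis encode_inj prod.inject prod_encode_eq)
  with cd * show ?thesis by (intro exI[of _ c]) (simp add: case_prod_beta)
next
  fix u
  assume *: "u \<in> S" "prog t = 8 + 4 * prog u" "inp u = prod_encode (inp t, outp t)" "outp u = 0"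
    "\<forall>k<outp t. \<exists>v\<in>S. prog v = prog u \<and> inp v = prod_encode (inp t, k) \<and> outp v \<noteq> 0"
  obtain c where c: "prog u = encode c" "eval c q (inp u) = Some (outp u)" using S *(1) by metis
  have less: "\<exists>y. eval c q (prod_encode (inp t, k)) = Some y \<and> y \<noteq> 0" if "k < outp t" for k
    using *(5) that S c(1) encode_inj by metis
  have "(LEAST n. eval c q (prod_encode (inp t, n)) = Some 0) = outp t"
  proof (rule Least_equality)
    show "eval c q (prod_encode (inp t, outp t)) = Some 0" using c * by simp
    show "outp t \<le> n" if "eval c q (prod_encode (inp t, n)) = Some 0" for n
      using less[of n] that by (cases "n < outp t") auto
  qed
  moreover have "eval c q (prod_encode (inp t, outp t)) = Some 0" using c * by simp
  moreover have "\<forall>k<outp t. eval c q (prod_encode (inp t, k)) \<noteq> None"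
    using less by fastforce
  ultimately have "eval (Find c) q (inp t) = Some (outp t)"
    by (simp only: eval.simps) (subst if_P, blast, simp)
  with * c show ?thesis by (intro exI[of _ "Find c"]) simp
qed

lemma derivation_sound:
  assumes "derivation w" "agrees w q" "t \<in> entries w"
  shows "\<exists>c. prog t = encode c \<and> eval c q (inp t) = Some (outp t)"
proof -
  have "\<exists>c. prog (entry w i) = encode c \<and> eval c q (inp (entry w i)) = Some (outp (entry w i))"
    if "i < pr1 w" for i
    using that
  proof (induction i rule: less_induct)
    case (less i)
    show ?case
    proof (rule justified_sound)
      show "justified (entry w ` {..<i}) (entry w i)"
        using assms(1) less.prems by (simp add: derivation_def)
      show "prog (entry w i) = 4 \<Longrightarrow> outp (entry w i) = q (inp (entry w i))"
        using assms(2) less.prems by (simp add: agrees_def entries_def)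
    qed (use less in auto)
  qed
  then show ?thesis using assms(3) by (auto simp: entries_def)
qed

text \<open>Completeness is proved with plain lists, which can be concatenated, and with correct
  oracle answers built in; the coding by a number is applied only at the end.\<close>

definition derives :: "baire \<Rightarrow> nat list \<Rightarrow> bool" where
  "derives q xs \<longleftrightarrow> (\<forall>i<length xs. justified (set (take i xs)) (xs ! i) \<and>
     (prog (xs ! i) = 4 \<longrightarrow> outp (xs ! i) = q (inp (xs ! i))))"

lemma derives_append:
  assumes "derives q xs" "derives q ys"
  shows "derives q (xs @ ys)"
  unfolding derives_def
proof (intro allI impI)
  fix i assume i: "i < length (xs @ ys)"
  show "justified (set (take i (xs @ ys))) ((xs @ ys) ! i) \<and>
    (prog ((xs @ ys) ! i) = 4 \<longrightarrow> outp ((xs @ ys) ! i) = q (inp ((xs @ ys) ! i)))"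
  proof (cases "i < length xs")
    case True
    then show ?thesis using assms(1) by (simp add: derives_def nth_append)
  next
    case False
    with i have "justified (set (take (i - length xs) ys)) (ys ! (i - length xs)) \<and>
      (prog (ys ! (i - length xs)) = 4 \<longrightarrow> outp (ys ! (i - length xs)) = q (inp (ys ! (i - length xs))))"
      using assms(2) by (simp add: derives_def)
    with False show ?thesis by (auto simp: nth_append elim: justified_mono)
  qed
qed

lemma derives_snoc:
  "derives q xs \<Longrightarrow> justified (set xs) t \<Longrightarrow> (prog t = 4 \<Longrightarrow> outp t = q (inp t)) \<Longrightarrow>
   derives q (xs @ [t])"
  unfolding derives_def by (auto simp: nth_append less_Suc_eq)

lemma derives_finite:
  assumes "finite T" "\<And>t. t \<in> T \<Longrightarrow> \<exists>xs. derives q xs \<and> t \<in> set xs"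
  shows "\<exists>xs. derives q xs \<and> T \<subseteq> set xs"
  using assms
proof (induction T)
  case empty
  show ?case by (intro exI[of _ "[]"]) (simp add: derives_def)
next
  case (insert t T)
  then obtain xs where "derives q xs" "T \<subseteq> set xs" by auto
  moreover obtain ys where "derives q ys" "t \<in> set ys" using insert.prems by auto
  ultimately show ?case by (intro exI[of _ "xs @ ys"]) (auto intro: derives_append)
qed

lemma derives_step:
  assumes "finite T" "\<And>t. t \<in> T \<Longrightarrow> \<exists>xs. derives q xs \<and> t \<in> set xs"
    and "justified T t" "prog t = 4 \<Longrightarrow> outp t = q (inp t)"
  shows "\<exists>xs. derives q xs \<and> t \<in> set xs"
proof -
  obtain xs where "derives q xs" "T \<subseteq> set xs" using derives_finite[OF assms(1,2)] by blast
  then show ?thesis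
    using assms(3,4) by (intro exI[of _ "xs @ [t]"]) (auto intro: derives_snoc justified_mono)
qed

abbreviation triple :: "code \<Rightarrow> nat \<Rightarrow> nat \<Rightarrow> nat" where
  "triple c x y \<equiv> prod_encode (encode c, prod_encode (x, y))"

lemma derives_complete: "eval c q x = Some y \<Longrightarrow> \<exists>xs. derives q xs \<and> triple c x y \<in> set xs"
proof (induction c arbitrary: x y)
  case (Pair c d)
  then obtain a b where ab: "eval c q x = Some a" "eval d q x = Some b" "y = prod_encode (a, b)"
    by (auto split: option.splits)
  show ?case
    by (rule derives_step[of "{triple c x a, triple d x b}"])
      (use Pair.IH ab in \<open>auto simp: justified_def\<close>)
next
  case (Comp c d)
  then obtain a where a: "eval d q x = Some a" "eval c q a = Some y"
    by (auto simp: bind_eq_Some_conv)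
  show ?case
    by (rule derives_step[of "{triple c a y, triple d x a}"])
      (use Comp.IH a in \<open>auto simp: justified_def\<close>)
next
  case (Prec c d)
  obtain a m where x: "x = prod_encode (a, m)" by (metis prod_decode_inverse surj_pair)
  have "\<exists>xs. derives q xs \<and> triple (Prec c d) (prod_encode (a, m)) y \<in> set xs"
    if "eval (Prec c d) q (prod_encode (a, m)) = Some y" for y
    using that
  proof (induction m arbitrary: y)
    case 0
    show ?case
      by (rule derives_step[of "{triple c a y}"])
        (use Prec.IH 0 le_prod_encode_2[of "encode d" "encode c"] in
          \<open>auto simp: justified_def intro!: exI[of _ "encode d"]\<close>)
  next
    case (Suc m)
    then obtain r where r: "eval (Prec c d) q (prod_encode (a, m)) = Some r"
      "eval d q (prod_encode (a, prod_encode (m, r))) = Some y"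
      by (auto simp: bind_eq_Some_conv)
    show ?case
      by (rule derives_step[of "{triple (Prec c d) (prod_encode (a, m)) r,
            triple d (prod_encode (a, prod_encode (m, r))) y}"])
        (use Suc.IH[OF r(1)] Prec.IH(2)[OF r(2)] le_prod_encode_1[of "encode c" "encode d"] in
          \<open>auto simp: justified_def intro!: exI[of _ "encode c"]\<close>)
  qed
  then show ?case using Prec.prems x by blast
next
  case (Find c)
  let ?e = "\<lambda>n. eval c q (prod_encode (x, n))"
  obtain n where n: "?e n = Some 0" "\<forall>k<n. ?e k \<noteq> None" and y: "y = (LEAST n. ?e n = Some 0)"
    using Find.prems by (auto split: if_splits)
  have y0: "?e y = Some 0" unfolding y using n(1) by (rule LeastI)
  \<comment> \<open>\<open>Find\<close> guarantees values only below some zero \<open>n\<close>; the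
    least zero is at or below it, so everything below \<open>y\<close> is defined and
    nonzero.\<close>
  have "y \<le> n" unfolding y using n(1) by (rule Least_le)
  have "\<exists>z. ?e k = Some z \<and> z \<noteq> 0" if "k < y" for k
  proof -
    have "?e k \<noteq> Some 0" using that unfolding y by (rule not_less_Least)
    moreover have "?e k \<noteq> None" using n(2) that \<open>y \<le> n\<close> by (meson less_le_trans)
    ultimately show ?thesis by (cases "?e k") auto
  qed
  then obtain z where z: "?e k = Some (z k)" "z k \<noteq> 0" if "k < y" for k by metis
  define T where "T = insert (triple c (prod_encode (x, y)) 0)
    ((\<lambda>k. triple c (prod_encode (x, k)) (z k)) ` {..<y})"
  have T: "triple c (prod_encode (x, y)) 0 \<in> T"
    "\<And>k. k < y \<Longrightarrow> triple c (prod_encode (x, k)) (z k) \<in> T" "finite T"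
    by (auto simp: T_def)
  show ?case
  proof (rule derives_step[of T])
    show "\<exists>xs. derives q xs \<and> t \<in> set xs" if "t \<in> T" for t
      using that Find.IH[OF y0] Find.IH[OF z(1)] unfolding T_def by blast
    have "\<forall>k<y. \<exists>v\<in>T. prog v = encode c \<and> inp v = prod_encode (x, k) \<and> outp v \<noteq> 0"
    proof (intro allI impI)
      fix k assume "k < y"
      then show "\<exists>v\<in>T. prog v = encode c \<and> inp v = prod_encode (x, k) \<and> outp v \<noteq> 0"
        using z(2) by (intro bexI[OF _ T(2)]) simp_all
    qed
    then show "justified T (triple (Find c) x y)"
      unfolding justified_def
      by (intro disjI2 bexI[OF _ T(1)]) simp
  qed (simp_all add: T)
next
  case Zero
  show ?case by (rule derives_step[of "{}"]) (use Zero in \<open>auto simp: justified_def\<close>)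
next
  case Succ
  show ?case by (rule derives_step[of "{}"]) (use Succ in \<open>auto simp: justified_def\<close>)
next
  case Left
  show ?case by (rule derives_step[of "{}"]) (use Left in \<open>auto simp: justified_def\<close>)
next
  case Right
  show ?case by (rule derives_step[of "{}"]) (use Right in \<open>auto simp: justified_def\<close>)
next
  case Oracle
  show ?case by (rule derives_step[of "{}"]) (use Oracle in \<open>auto simp: justified_def\<close>)
qed

lemma code_list: "\<exists>w. pr1 w = length xs \<and> (\<forall>i<length xs. entry w i = xs ! i)"
proof -
  have "\<exists>v. \<forall>i<length xs. pr1 (rec_nat v (\<lambda>_ r. pr2 r) i) = xs ! i"
  proof (induction xs)
    case (Cons x xs)
    then obtain v where v: "\<forall>i<length xs. pr1 (rec_nat v (\<lambda>_ r. pr2 r) i) = xs ! i" by blast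
    \<comment> \<open>Iterating \<open>pr2\<close> from the pair lags one step behind iterating it
      from \<open>v\<close>, which shifts the indices of the tail by one.\<close>
    have "pr2 (rec_nat (prod_encode (x, v)) (\<lambda>_ r. pr2 r) i) = rec_nat v (\<lambda>_ r. pr2 r) i" for i
      by (induction i) auto
    with v show ?case
      by (intro exI[of _ "prod_encode (x, v)"]) (auto simp: less_Suc_eq_0_disj)
  qed simp
  then obtain v where "\<forall>i<length xs. pr1 (rec_nat v (\<lambda>_ r. pr2 r) i) = xs ! i" ..
  then show ?thesis by (intro exI[of _ "prod_encode (length xs, v)"]) (simp add: entry_def)
qed

lemma derivation_complete:
  assumes "eval c q x = Some y"
  shows "\<exists>w. derivation w \<and> agrees w q \<and> triple c x y \<in> entries w"
proof -
  obtain xs where xs: "derives q xs" "triple c x y \<in> set xs"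
    using derives_complete[OF assms] by blast
  obtain w where w: "pr1 w = length xs" "\<And>i. i < length xs \<Longrightarrow> entry w i = xs ! i"
    using code_list by blast
  have take: "entry w ` {..<i} = set (take i xs)" if "i \<le> length xs" for i
  proof -
    have "take i xs = map (entry w) [0..<i]"
      using that w(2) by (intro nth_equalityI) auto
    then show ?thesis by (simp add: atLeast0LessThan)
  qed
  show ?thesis
  proof (intro exI[of _ w] conjI)
    show "derivation w" using xs(1) w take by (simp add: derivation_def derives_def)
    show "agrees w q" using xs(1) w by (auto simp: agrees_def entries_def derives_def)
    show "triple c x y \<in> entries w" using xs(2) w take[of "length xs"] by (simp add: entries_def)
  qed
qed

text \<open>A normal form in which the unbounded search ranges over oracle-free objects, and the
  oracle enters only through the finitely many answers tested by \<open>agrees\<close>. The game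
  turns the former into a move and the latter into challenges.\<close>

lemma mem_jump_iff:
  "e \<in> jump q \<longleftrightarrow>
     (\<exists>w. derivation w \<and> agrees w q \<and> (\<exists>t\<in>entries w. prog t = e \<and> inp t = e))"
proof
  assume "e \<in> jump q"
  then obtain c y where "e = encode c" "eval c q e = Some y" by (auto simp: jump_def)
  then show "\<exists>w. derivation w \<and> agrees w q \<and> (\<exists>t\<in>entries w. prog t = e \<and> inp t = e)"
    using derivation_complete[of c q e y] by force
next
  assume "\<exists>w. derivation w \<and> agrees w q \<and> (\<exists>t\<in>entries w. prog t = e \<and> inp t = e)"
  then show "e \<in> jump q" using derivation_sound unfolding jump_def by force
qed

section \<open>Decidability of derivations and a universal program\<close>

lemma decidable_Bex_lessThan [rec_intros]:
  assumes "decidable (\<lambda>p m. P p (pr1 m) (pr2 m))" "recursive b"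
  shows "decidable (\<lambda>p n. \<exists>k\<in>{..<b p n}. P p n k)"
  unfolding lessThan_iff Bex_def Ball_def using decidable_bex[of P, OF assms] by simp

lemma recursive_entry [rec_intros]:
  assumes "recursive f" "recursive g"
  shows "recursive (\<lambda>p n. entry (f p n) (g p n))"
  unfolding entry_def by (intro recursive_rec_nat rec_intros assms)

lemma bex_image: "(\<exists>x\<in>f ` A. P x) \<longleftrightarrow> (\<exists>x\<in>A. P (f x))"
  by blast

lemma decidable_derivation [rec_intros]:
  assumes "recursive f"
  shows "decidable (\<lambda>p n. derivation (f p n))"
proof -
  have "decidable (\<lambda>p. derivation)"
    unfolding derivation_def justified_def bex_image
    by (intro rec_intros)
  from decidable_comp[OF this assms] show ?thesis .
qed

lemma decidable_Bex_entries [rec_intros]: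
  assumes "decidable (\<lambda>p m. P p (pr1 m) (pr2 m))" "recursive f"
  shows "decidable (\<lambda>p n. \<exists>t\<in>entries (f p n). P p n t)"
  unfolding entries_def bex_image
  by (intro rec_intros decidable_comp2[of P, OF assms(1)] assms(2) recursive_comp[OF assms(2)])

lemma decidable_Ball_entries [rec_intros]:
  assumes "decidable (\<lambda>p m. P p (pr1 m) (pr2 m))" "recursive f"
  shows "decidable (\<lambda>p n. \<forall>t\<in>entries (f p n). P p n t)"
proof -
  have "decidable (\<lambda>p n. \<not> (\<exists>t\<in>entries (f p n). \<not> P p n t))"
    by (intro rec_intros assms)
  then show ?thesis by simp
qed

text \<open>The search runs over pairs of a derivation and an output. Soundness makes every hit
  correct, so the least one may be taken; completeness provides a hit whenever the computation
  halts.\<close>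

lemma universal_code:
  obtains u where "\<And>c p n. eval u p (prod_encode (encode c, n)) = eval c p n"
proof -
  define R where "R p x k \<longleftrightarrow> derivation (pr1 k) \<and> agrees (pr1 k) p \<and>
    (\<exists>t\<in>entries (pr1 k). prog t = pr1 x \<and> inp t = pr2 x \<and> outp t = pr2 k)" for p x k
  have "decidable (\<lambda>p m. R p (pr1 m) (pr2 m))"
    unfolding R_def agrees_def by (intro rec_intros)
  then obtain s where s: "\<And>p n. eval s p n = (if \<exists>k. R p n k then Some (LEAST k. R p n k) else None)"
    using search_code[of R] by blast
  have R: "R p (prod_encode (encode c, n)) k \<Longrightarrow> eval c p n = Some (pr2 k)" for c p n k
    unfolding R_def using derivation_sound encode_inj by fastforce
  have R': "eval c p n = Some y \<Longrightarrow> \<exists>w. R p (prod_encode (encode c, n)) (prod_encode (w, y))" for c p n y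
    using derivation_complete[of c p n y] unfolding R_def by force
  have "eval (Comp Right s) p (prod_encode (encode c, n)) = eval c p n" for c p n
  proof (cases "\<exists>k. R p (prod_encode (encode c, n)) k")
    case True
    then have "R p (prod_encode (encode c, n)) (LEAST k. R p (prod_encode (encode c, n)) k)"
      by (rule LeastI_ex)
    then show ?thesis using R True by (simp add: s)
  next
    case False
    then have "eval c p n = None" using R'[of c p n] by (cases "eval c p n") auto
    with False show ?thesis by (simp add: s)
  qed
  then show ?thesis by (rule that)
qed

section \<open>The forest of a directed graph\<close>

abbreviation kind :: "nat \<Rightarrow> nat" where "kind x \<equiv> pr1 (pr2 x)"

text \<open>Every number is a node: the first component is 0 at a root and \<open>Suc y\<close>
  below the node \<open>y\<close>; then come the position and the copy index. So the parent can be
  read off, and the vertex set is all of \<nat>. A number whose position is no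
  \<open>D\<close>-successor of its parent's has no edge upwards and merely heads another
  tree.\<close>

definition node :: "nat \<Rightarrow> nat \<Rightarrow> nat \<Rightarrow> nat" where
  "node h t i = prod_encode (h, prod_encode (t, i))"

abbreviation root :: "nat \<Rightarrow> nat" where "root t \<equiv> node 0 t 0"

definition child :: "(nat \<Rightarrow> nat \<Rightarrow> bool) \<Rightarrow> nat \<Rightarrow> nat \<Rightarrow> bool" where
  "child D y x \<longleftrightarrow> pr1 x = Suc y \<and> D (kind y) (kind x)"

definition forest :: "(nat \<Rightarrow> nat \<Rightarrow> bool) \<Rightarrow> nat set set" where
  "forest D = {{y, x} | y x. child D y x}"

lemma node_sel [simp]: "pr1 (node h t i) = h" "kind (node h t i) = t"
  by (simp_all add: node_def)

lemma pr1_le: "pr1 x \<le> x"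
  using le_prod_encode_1[of "pr1 x" "pr2 x"] by simp

lemma child_less: "child D y x \<Longrightarrow> y < x"
  using pr1_le[of x] by (simp add: child_def)

lemma parent_unique: "child D y x \<Longrightarrow> child D y' x \<Longrightarrow> y = y'"
  by (simp add: child_def)

text \<open>Parity of the depth along the parent links, counted even where \<open>D\<close> provides
  no edge; the recursion ends because a parent is a smaller number.\<close>

function level_even :: "nat \<Rightarrow> bool" where
  "level_even x \<longleftrightarrow> (case pr1 x of 0 \<Rightarrow> True | Suc y \<Rightarrow> \<not> level_even y)"
  by auto
termination
  by (relation "measure id") (auto, metis Suc_le_eq pr1_le)

declare level_even.simps [simp del]

lemma level_even_child: "child D y x \<Longrightarrow> level_even x \<longleftrightarrow> \<not> level_even y"
  by (subst level_even.simps) (simp add: child_def)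

lemma bipartite_forest: "bipartite_graph UNIV (forest D)"
proof -
  have "\<exists>a\<in>{x. level_even x}. \<exists>b\<in>{x. \<not> level_even x}. e = {a, b}" if "e \<in> forest D" for e
    using that level_even_child unfolding forest_def by blast
  then show ?thesis
    unfolding bipartite_graph_def
    by (intro exI[of _ "{x. level_even x}"] exI[of _ "{x. \<not> level_even x}"]) blast
qed

section \<open>Values of positions, and existence of a cover\<close>

inductive wins :: "(nat \<Rightarrow> nat \<Rightarrow> bool) \<Rightarrow> nat \<Rightarrow> bool" for D where
  "D t s \<Longrightarrow> (\<And>u. D s u \<Longrightarrow> wins D u) \<Longrightarrow> wins D t"

definition loses :: "(nat \<Rightarrow> nat \<Rightarrow> bool) \<Rightarrow> nat \<Rightarrow> bool" where
  "loses D s \<longleftrightarrow> (\<forall>u. D s u \<longrightarrow> wins D u)"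

lemma wins_iff: "wins D t \<longleftrightarrow> (\<exists>s. D t s \<and> loses D s)"
  by (subst wins.simps) (auto simp: loses_def)

text \<open>By induction on the win: if \<open>t\<close> is won through \<open>s\<close>, no reply
  to \<open>s\<close> is lost. Were \<open>t\<close> lost, \<open>s\<close> would be won and hence
  have a lost reply.\<close>

lemma not_wins_and_loses: "wins D t \<Longrightarrow> \<not> loses D t"
proof (induction rule: wins.induct)
  case (1 t s)
  then show ?case by (metis loses_def wins_iff)
qed

text \<open>
  Won nodes are matched with a lost child. An undecided node always has an undecided child, so the
  undecided nodes on even levels can be matched downwards.
\<close>

lemma konig_cover_forest: "\<exists>C M. konig_cover (forest D) C M"
proof -
  define draw where "draw t \<longleftrightarrow> \<not> wins D t \<and> \<not> loses D t" for t
  define C where "C = {x. wins D (kind x) \<or> draw (kind x) \<and> level_even x}"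
  have ex: "\<exists>y. child D x y \<and> y \<notin> C" if x: "x \<in> C" for x
  proof (cases "wins D (kind x)")
    case True
    then obtain s where "D (kind x) s" "loses D s" by (auto simp: wins_iff)
    then show ?thesis
      by (intro exI[of _ "node (Suc x) s 0"])
        (use not_wins_and_loses in \<open>auto simp: child_def C_def draw_def\<close>)
  next
    case False
    with x have d: "draw (kind x)" "level_even x" by (auto simp: C_def)
    then obtain s where s: "D (kind x) s" "\<not> wins D s" by (auto simp: draw_def loses_def)
    then have ch: "child D x (node (Suc x) s 0)" by (simp add: child_def)
    then show ?thesis using s level_even_child[OF ch] d by (auto simp: C_def)
  qed
  then obtain m where m: "\<And>x. x \<in> C \<Longrightarrow> child D x (m x)" "\<And>x. x \<in> C \<Longrightarrow> m x \<notin> C"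
    by metis
  define M where "M = (\<lambda>x. {x, m x}) ` C"
  have cover: "e \<inter> C \<noteq> {}" if e_in: "e \<in> forest D" for e
  proof -
    obtain y x where e: "e = {y, x}" "child D y x"
      using e_in unfolding forest_def by blast
    have D: "D (kind y) (kind x)" using e(2) by (simp add: child_def)
    show ?thesis
    proof (cases "y \<in> C")
      case False
      then have "\<not> wins D (kind y)" by (simp add: C_def)
      with D have "\<not> loses D (kind x)" by (auto simp: wins_iff)
      \<comment> \<open>If \<open>y\<close> is lost then \<open>x\<close> is won; otherwise
        \<open>y\<close> is drawn and, being outside \<open>C\<close>, on an odd level, so
        \<open>x\<close> is on an even one.\<close>
      moreover have "level_even x \<or> wins D (kind x)"
        using False D level_even_child[OF e(2)] \<open>\<not> wins D (kind y)\<close>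
        by (auto simp: C_def draw_def loses_def)
      ultimately show ?thesis using e by (auto simp: C_def draw_def)
    qed (use e in auto)
  qed
  have "pairwise disjnt M"
  proof (rule pairwiseI)
    fix e e' assume "e \<in> M" "e' \<in> M" "e \<noteq> e'"
    then obtain x x' where *: "e = {x, m x}" "e' = {x', m x'}" "x \<in> C" "x' \<in> C" "x \<noteq> x'"
      by (auto simp: M_def)
    then have "m x \<noteq> m x'" using m(1) parent_unique by metis
    moreover have "x \<noteq> m x'" "x' \<noteq> m x" using m(2) * by metis+
    ultimately show "disjnt e e'" using * by (auto simp: disjnt_def)
  qed
  moreover have "M \<subseteq> forest D" using m(1) by (auto simp: M_def forest_def)
  moreover have "\<exists>f. (\<forall>e\<in>M. f e \<in> e) \<and> C = f ` M"
  proof -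
    \<comment> \<open>The endpoint chosen from a matching edge is the upper one, and the edge
      determines it since its lower endpoint is outside \<open>C\<close>.\<close>
    have inj: "inj_on (\<lambda>x. {x, m x}) C"
      using m(2) by (intro inj_onI) (auto simp: doubleton_eq_iff)
    show ?thesis
      unfolding M_def
      by (intro exI[of _ "inv_into C (\<lambda>x. {x, m x})"])
        (use inj inv_into_f_f[OF inj] in \<open>simp add: inv_into_image_cancel\<close>)
  qed
  ultimately have "konig_cover (forest D) C M"
    using cover unfolding konig_cover_def by (intro conjI ballI)
  then show ?thesis by blast
qed

text \<open>A node fails to be good if it is in the cover on account of the edge to its parent.\<close>

definition good :: "nat set \<Rightarrow> (nat \<Rightarrow> nat \<Rightarrow> bool) \<Rightarrow> nat \<Rightarrow> bool" where
  "good C m x \<longleftrightarrow> \<not> (x \<in> C \<and> pr1 x \<noteq> 0 \<and> m (pr1 x - 1) x)"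

text \<open>Goodness is demanded of the covered node alone, because nodes outside the cover are
  always good.\<close>

definition fault :: "nat set \<Rightarrow> (nat \<Rightarrow> nat \<Rightarrow> bool) \<Rightarrow> nat \<Rightarrow> nat \<Rightarrow> bool" where
  "fault C m y y' \<longleftrightarrow> good C m y \<and> y \<in> C \<and> y' \<notin> C \<and> kind y = kind y'"

abbreviation edge_in :: "nat set set \<Rightarrow> nat \<Rightarrow> nat \<Rightarrow> bool" where
  "edge_in M \<equiv> (\<lambda>x y. {x, y} \<in> M)"

lemma good_root [simp]: "good C m (root t)"
  by (simp add: good_def)

text \<open>Edges are unordered; the orientation is recovered because a parent is a smaller number
  than its child.\<close>

lemma forest_child: "{y, x} \<in> forest D \<Longrightarrow> pr1 x = Suc y \<Longrightarrow> child D y x"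
proof -
  assume "{y, x} \<in> forest D" and x: "pr1 x = Suc y"
  then obtain a b where ab: "{y, x} = {a, b}" "child D a b" unfolding forest_def by blast
  then consider "child D y x" | "child D x y" unfolding doubleton_eq_iff by blast
  then show ?thesis
  proof cases
    case 2
    then have "x < y" by (rule child_less)
    then show ?thesis using x pr1_le[of x] by simp
  qed
qed

text \<open>A covered node is chosen from some matching edge; for a good one this is not the edge to
  its parent, so it leads to a child. The child is uncovered, since the only matching edge
  containing it has already contributed \<open>x\<close>.\<close>

lemma cover_child_out:
  assumes K: "konig_cover (forest D) C M" and x: "good C (edge_in M) x" "x \<in> C"
  shows "\<exists>y. child D x y \<and> {x, y} \<in> M \<and> y \<notin> C"
proof -
  obtain f where f: "\<forall>e\<in>M. f e \<in> e" "C = f ` M" and M: "M \<subseteq> forest D" "pairwise disjnt M"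
    using K by (auto simp: konig_cover_def)
  obtain e where e: "e \<in> M" "f e = x" using x(2) f(2) by auto
  then have "x \<in> e" "e \<in> forest D" using f(1) M(1) by auto
  then obtain y where y: "e = {x, y}" "child D x y \<or> child D y x" by (auto simp: forest_def)
  have ch: "child D x y"
    using y e x by (auto simp: good_def child_def insert_commute)
  have "y \<notin> C"
  proof
    assume "y \<in> C"
    then obtain e' where e': "e' \<in> M" "f e' = y" using f(2) by auto
    then have "y \<in> e'" "y \<in> e" using f(1) y by auto
    then have "e = e'" using M(2) e(1) e'(1) by (auto simp: pairwise_def disjnt_def)
    then show False using e(2) e'(2) child_less[OF ch] by simp
  qed
  then show ?thesis using ch e y by auto
qed

text \<open>The edges from an uncovered node must be covered by its children, and at most one
  matching edge meets \<open>x\<close>, so one of the copies 0 and 1 is good.\<close>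

lemma cover_child_in:
  assumes K: "konig_cover (forest D) C M" and x: "x \<notin> C" "D (kind x) t"
  shows "\<exists>y. child D x y \<and> kind y = t \<and> y \<in> C \<and> good C (edge_in M) y"
proof -
  let ?y = "\<lambda>i. node (Suc x) t i"
  have ch: "child D x (?y i)" for i using x by (simp add: child_def)
  then have "{x, ?y i} \<in> forest D" for i by (auto simp: forest_def)
  moreover have "\<forall>e\<in>forest D. e \<inter> C \<noteq> {}" using K by (simp add: konig_cover_def)
  ultimately have "{x, ?y i} \<inter> C \<noteq> {}" for i by blast
  then have C: "?y i \<in> C" for i using x(1) by blast
  have "\<not> ({x, ?y 0} \<in> M \<and> {x, ?y 1} \<in> M)"
  proof
    assume *: "{x, ?y 0} \<in> M \<and> {x, ?y 1} \<in> M"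
    have "?y 0 \<noteq> ?y 1" by (simp add: node_def)
    moreover have "x \<noteq> ?y 1" using child_less[OF ch[of 1]] by simp
    ultimately have "{x, ?y 0} \<noteq> {x, ?y 1}" unfolding doubleton_eq_iff by blast
    moreover have "pairwise disjnt M" using K by (simp add: konig_cover_def)
    ultimately have "disjnt {x, ?y 0} {x, ?y 1}" using * by (meson pairwiseD)
    then show False by simp
  qed
  then obtain i where "{x, ?y i} \<notin> M" by blast
  then show ?thesis using C ch by (intro exI[of _ "?y i"]) (simp add: good_def)
qed

text \<open>The roles swap: \<open>y\<close> yields the uncovered child \<open>z\<close>, while
  \<open>y'\<close> has a good covered child with the same position. Retaining the matching edge
  from \<open>y\<close> to \<open>z\<close> certifies that the positions follow
  \<open>D\<close>.\<close>

lemma fault_step: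
  assumes K: "konig_cover (forest D) C M" and "fault C (edge_in M) y y'"
  shows "\<exists>z z'. pr1 z = Suc y \<and> {y, z} \<in> M \<and> pr1 z' = Suc y' \<and> fault C (edge_in M) z' z"
proof -
  obtain z where z: "child D y z" "{y, z} \<in> M" "z \<notin> C"
    using cover_child_out[OF K] assms(2) by (auto simp: fault_def)
  then have "D (kind y') (kind z)" using assms(2) by (simp add: fault_def child_def)
  then obtain z' where "child D y' z'" "kind z' = kind z" "z' \<in> C" "good C (edge_in M) z'"
    using cover_child_in[OF K] assms(2) by (auto simp: fault_def)
  with z show ?thesis by (intro exI[of _ z] exI[of _ z']) (simp add: fault_def child_def)
qed

lemma matched_child_edge:
  assumes "konig_cover (forest D) C M" "{y, z} \<in> M" "pr1 z = Suc y"
  shows "D (kind y) (kind z)"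
  using forest_child[of y z D] assms by (auto simp: konig_cover_def child_def)

text \<open>Roots are always good, so a root serves as the reference copy of its position: without
  faults, an uncovered copy or a good covered one must agree with it.\<close>

lemma no_fault_kernel:
  assumes K: "konig_cover (forest D) C M" and nf: "\<And>y y'. \<not> fault C (edge_in M) y y'"
  shows "root t \<in> C \<longleftrightarrow> (\<exists>s. D t s \<and> root s \<notin> C)"
proof
  assume "root t \<in> C"
  then obtain z where z: "child D (root t) z" "z \<notin> C"
    using cover_child_out[OF K] good_root by blast
  then have "root (kind z) \<notin> C" using nf[of "root (kind z)" z] by (auto simp: fault_def)
  with z show "\<exists>s. D t s \<and> root s \<notin> C" by (auto simp: child_def)
next
  assume "\<exists>s. D t s \<and> root s \<notin> C"
  then obtain s where s: "D t s" "root s \<notin> C" by blast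
  show "root t \<in> C"
  proof (rule ccontr)
    assume "root t \<notin> C"
    then obtain y where "kind y = s" "y \<in> C" "good C (edge_in M) y"
      using cover_child_in[OF K, of "root t" s] s by auto
    with nf[of y "root s"] s show False by (simp add: fault_def)
  qed
qed

section \<open>A game for jump hierarchies\<close>

text \<open>
  An instance \<open>(L, A)\<close> is handled through its name \<open>p\<close>, so that everything is visibly
  decidable in \<open>p\<close>.
\<close>

definition leq :: "baire \<Rightarrow> nat \<Rightarrow> nat \<Rightarrow> bool" where
  "leq p a b \<longleftrightarrow> p (2 * prod_encode (a, b)) = 1"

definition lt :: "baire \<Rightarrow> nat \<Rightarrow> nat \<Rightarrow> bool" where
  "lt p a b \<longleftrightarrow> leq p a b \<and> a \<noteq> b"

definition start_set :: "baire \<Rightarrow> nat \<Rightarrow> bool" where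
  "start_set p n \<longleftrightarrow> p (2 * n + 1) = 1"

definition asks :: "nat \<Rightarrow> nat \<Rightarrow> nat \<Rightarrow> bool" where
  "asks w x y \<longleftrightarrow> (\<exists>t\<in>entries w. prog t = 4 \<and> inp t = x \<and> outp t = y)"

text \<open>Answers that cannot be right are ruled out when the derivation is put forward: the
  oracle is a characteristic function and is 0 outside the stages below \<open>b\<close>. What
  remains to be challenged concerns those stages.\<close>

definition certifies :: "baire \<Rightarrow> nat \<Rightarrow> nat \<Rightarrow> nat \<Rightarrow> bool" where
  "certifies p b e w \<longleftrightarrow> derivation w \<and> (\<exists>t\<in>entries w. prog t = e \<and> inp t = e) \<and>
     (\<forall>t\<in>entries w. prog t = 4 \<longrightarrow> outp t = 0 \<or> outp t = 1 \<and> lt p (pr1 (inp t)) b)"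

abbreviation tag :: "nat \<Rightarrow> nat" where "tag t \<equiv> pr1 t"
abbreviation lab :: "nat \<Rightarrow> nat" where "lab t \<equiv> pr1 (pr2 t)"
abbreviation arg :: "nat \<Rightarrow> nat" where "arg t \<equiv> pr2 (pr2 t)"

text \<open>
  The positions \<open>(0, b, n)\<close> and \<open>(2, b, n)\<close> claim that \<open>n\<close> is, respectively is not, a member of
  \<open>X\<^sub>b\<close>. A position \<open>(1, b, w)\<close> is lost if \<open>b\<close> is not the first element and all oracle answers
  in the derivation \<open>w\<close> are correct for stage \<open>b\<close>. Finally, \<open>(3, b, _)\<close> claims that \<open>b\<close> is not
  the first element, and \<open>(4, _, _)\<close> that there is a first element.
\<close>

definition move :: "baire \<Rightarrow> nat \<Rightarrow> nat \<Rightarrow> bool" where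
  "move p t s \<longleftrightarrow>
     tag t = 0 \<and> lab s = lab t \<and>
       (tag s = 1 \<and> certifies p (lab t) (arg t) (arg s) \<or> tag s = 3 \<and> start_set p (arg t)) \<or>
     tag t = 1 \<and>
       (lt p (lab s) (lab t) \<and>
          (tag s = 0 \<and> asks (arg t) (pr2 s) 1 \<or> tag s = 2 \<and> asks (arg t) (pr2 s) 0) \<or>
        tag s = 3 \<and> lab s = lab t) \<or>
     tag t = 2 \<and> tag s = 0 \<and> pr2 s = pr2 t \<or>
     tag t = 3 \<and> tag s = 5 \<and> lt p (lab s) (lab t) \<or>
     tag t = 4 \<and> tag s = 3 \<and> leq p (lab s) (lab s)"

text \<open>Paths through tags 3, 4 or 5 soon end, and the two moves after \<open>t3\<close> exclude
  them. Among the other tags the label drops exactly on leaving tag 1, and 2, 0, 1 is the longest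
  way there; hence three moves per descent.\<close>

lemma move_descends:
  assumes trans: "\<And>a b c. lt p a b \<Longrightarrow> lt p b c \<Longrightarrow> lt p a c"
    and "move p t0 t1" "move p t1 t2" "move p t2 t3" "move p t3 t4" "move p t4 t5"
  shows "lt p (lab t3) (lab t0)"
proof -
  have dead: "tag s \<noteq> 5" if "move p s s'" for s s'
    using that by (auto simp: move_def)
  have dead3: "tag s \<noteq> 3" if "move p s s'" "move p s' s''" for s s' s''
    using that dead[of s' s''] by (auto simp: move_def)
  have step: "tag t = 0 \<and> tag s = 1 \<and> lab s = lab t \<or>
      tag t = 1 \<and> (tag s = 0 \<or> tag s = 2) \<and> lt p (lab s) (lab t) \<or>
      tag t = 2 \<and> tag s = 0 \<and> lab s = lab t"
    if "move p t s" "move p s s'" "move p s' s''" for t s s' s''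
    using that(1) dead[OF that(2)] dead3[OF that(2,3)] by (auto simp: move_def)
  from step[OF assms(2-4)] step[OF assms(3-5)] step[OF assms(4-6)]
  show ?thesis
    by (elim disjE conjE; simp; blast intro: trans)
qed

text \<open>The equation is unfolded one tag at a time, without induction along \<open>L\<close>, so
  ill-founded orderings are covered too.\<close>

locale kernel =
  fixes p :: baire and v :: "nat \<Rightarrow> bool"
  assumes kernel: "v t \<longleftrightarrow> (\<exists>s. move p t s \<and> \<not> v s)"
begin

lemma kernel_5: "\<not> v (prod_encode (5, m))"
  by (subst kernel) (simp add: move_def)

lemma kernel_3: "v (prod_encode (3, prod_encode (b, n))) \<longleftrightarrow> (\<exists>a. lt p a b)"
proof
  assume "v (prod_encode (3, prod_encode (b, n)))"
  then show "\<exists>a. lt p a b" unfolding kernel[of "prod_encode (3, _)"] by (auto simp: move_def)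
next
  assume "\<exists>a. lt p a b"
  then obtain a where "lt p a b" ..
  then have "move p (prod_encode (3, prod_encode (b, n))) (prod_encode (5, prod_encode (a, 0)))"
    by (simp add: move_def)
  then show "v (prod_encode (3, prod_encode (b, n)))" using kernel kernel_5 by blast
qed

lemma kernel_4: "v (prod_encode (4, m)) \<longleftrightarrow> (\<exists>b. leq p b b \<and> \<not> (\<exists>a. lt p a b))"
proof
  assume "v (prod_encode (4, m))"
  then obtain s where "move p (prod_encode (4, m)) s" "\<not> v s" using kernel by blast
  then have "tag s = 3" "leq p (lab s) (lab s)" by (auto simp: move_def)
  moreover have "s = prod_encode (tag s, prod_encode (lab s, arg s))" by simp
  ultimately show "\<exists>b. leq p b b \<and> \<not> (\<exists>a. lt p a b)"
    using kernel_3 \<open>\<not> v s\<close> by metis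
next
  assume "\<exists>b. leq p b b \<and> \<not> (\<exists>a. lt p a b)"
  then obtain b where b: "leq p b b" "\<not> (\<exists>a. lt p a b)" by blast
  then have "move p (prod_encode (4, m)) (prod_encode (3, prod_encode (b, 0)))"
    by (simp add: move_def)
  then show "v (prod_encode (4, m))" using kernel kernel_3 b(2) by blast
qed

lemma kernel_2: "v (prod_encode (2, m)) \<longleftrightarrow> \<not> v (prod_encode (0, m))"
proof -
  have "move p (prod_encode (2, m)) s \<longleftrightarrow> s = prod_encode (0, m)" for s
    by (auto simp: move_def) (metis prod.collapse prod_decode_inverse)
  then show ?thesis using kernel[of "prod_encode (2, m)"] by simp
qed

lemma kernel_1:
  "v (prod_encode (1, prod_encode (b, w))) \<longleftrightarrow>
     \<not> (\<exists>a. lt p a b) \<or>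
     (\<exists>a n. lt p a b \<and>
        (asks w (prod_encode (a, n)) 1 \<and> \<not> v (prod_encode (0, prod_encode (a, n))) \<or>
         asks w (prod_encode (a, n)) 0 \<and> v (prod_encode (0, prod_encode (a, n)))))"
  (is "?l \<longleftrightarrow> ?r")
proof
  assume ?l
  then obtain s where s: "move p (prod_encode (1, prod_encode (b, w))) s" "\<not> v s"
    using kernel by blast
  have eq: "s = prod_encode (tag s, prod_encode (lab s, arg s))" "pr2 s = prod_encode (lab s, arg s)"
    by simp_all
  from s(1) consider
      "lt p (lab s) b" "tag s = 0" "asks w (pr2 s) 1"
    | "lt p (lab s) b" "tag s = 2" "asks w (pr2 s) 0"
    | "tag s = 3" "lab s = b"
    by (auto simp: move_def)
  then show ?r
  proof cases
    case 1
    then show ?thesis using s(2) eq by metis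
  next
    case 2
    then show ?thesis using s(2) eq kernel_2 by metis
  next
    case 3
    then show ?thesis using s(2) eq kernel_3 by metis
  qed
next
  assume ?r
  then consider "\<not> (\<exists>a. lt p a b)"
    | a n where "lt p a b" "asks w (prod_encode (a, n)) 1" "\<not> v (prod_encode (0, prod_encode (a, n)))"
    | a n where "lt p a b" "asks w (prod_encode (a, n)) 0" "\<not> v (prod_encode (2, prod_encode (a, n)))"
    using kernel_2 by blast
  then show ?l
  proof cases
    case 1
    moreover have "move p (prod_encode (1, prod_encode (b, w))) (prod_encode (3, prod_encode (b, 0)))"
      by (simp add: move_def)
    ultimately show ?thesis using kernel kernel_3 by blast
  next
    case (2 a n)
    then have "move p (prod_encode (1, prod_encode (b, w))) (prod_encode (0, prod_encode (a, n)))"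
      by (simp add: move_def)
    with 2 show ?thesis using kernel by blast
  next
    case (3 a n)
    then have "move p (prod_encode (1, prod_encode (b, w))) (prod_encode (2, prod_encode (a, n)))"
      by (simp add: move_def)
    with 3 show ?thesis using kernel by blast
  qed
qed

lemma kernel_0:
  "v (prod_encode (0, prod_encode (b, n))) \<longleftrightarrow>
     (\<exists>w. certifies p b n w \<and> \<not> v (prod_encode (1, prod_encode (b, w)))) \<or>
     \<not> (\<exists>a. lt p a b) \<and> start_set p n"
  (is "?l \<longleftrightarrow> ?r")
proof
  assume ?l
  then obtain s where s: "move p (prod_encode (0, prod_encode (b, n))) s" "\<not> v s"
    using kernel by blast
  have eq: "s = prod_encode (tag s, prod_encode (lab s, arg s))"
    by simp
  from s(1) consider "tag s = 1" "lab s = b" "certifies p b n (arg s)"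
    | "tag s = 3" "lab s = b" "start_set p n"
    by (auto simp: move_def)
  then show ?r
  proof cases
    case 1
    then show ?thesis using s(2) eq by metis
  next
    case 2
    then show ?thesis using s(2) eq kernel_3 by metis
  qed
next
  assume ?r
  then show ?l
  proof (elim disjE exE conjE)
    fix w assume w: "certifies p b n w" "\<not> v (prod_encode (1, prod_encode (b, w)))"
    then have "move p (prod_encode (0, prod_encode (b, n))) (prod_encode (1, prod_encode (b, w)))"
      by (simp add: move_def)
    with w show ?thesis using kernel by blast
  next
    assume b: "\<not> (\<exists>a. lt p a b)" "start_set p n"
    then have "move p (prod_encode (0, prod_encode (b, n))) (prod_encode (3, prod_encode (b, 0)))"
      by (simp add: move_def)
    with b show ?thesis using kernel kernel_3 by blast
  qed
qed

definition stage :: "nat \<Rightarrow> nat set" where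
  "stage a = {n. leq p a a \<and> v (prod_encode (0, prod_encode (a, n)))}"

text \<open>The work is divided: \<open>certifies\<close> forces the answer 0 on queries outside the
  stages below \<open>b\<close>, where \<open>Y\<close> has no elements, and the lost position with
  tag 1 forces correct answers about the stages below \<open>b\<close>.\<close>

lemma certifies_iff:
  assumes lt_field: "\<And>a. lt p a b \<Longrightarrow> leq p a a" and "\<exists>a. lt p a b"
    and Y: "Y = {prod_encode (a, n) | a n. lt p a b \<and> n \<in> stage a}"
  shows "certifies p b e w \<and> \<not> v (prod_encode (1, prod_encode (b, w))) \<longleftrightarrow>
    derivation w \<and> agrees w (char_fun Y) \<and> (\<exists>t\<in>entries w. prog t = e \<and> inp t = e)"
    (is "?l \<longleftrightarrow> ?r")
proof -
  have Y_iff: "prod_encode (a, n) \<in> Y \<longleftrightarrow> lt p a b \<and> v (prod_encode (0, prod_encode (a, n)))" for a n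
    using lt_field by (auto simp: Y stage_def)
  have v: "\<not> v (prod_encode (1, prod_encode (b, w))) \<longleftrightarrow>
    (\<forall>a n. lt p a b \<longrightarrow>
      (asks w (prod_encode (a, n)) 1 \<longrightarrow> v (prod_encode (0, prod_encode (a, n)))) \<and>
      (asks w (prod_encode (a, n)) 0 \<longrightarrow> \<not> v (prod_encode (0, prod_encode (a, n)))))"
    using kernel_1[of b w] assms(2) by blast
  show ?thesis
  proof
    assume l: ?l
    have "outp t = char_fun Y (inp t)" if t: "t \<in> entries w" "prog t = 4" for t
    proof -
      obtain a n where an: "inp t = prod_encode (a, n)" by (metis prod_decode_inverse surj_pair)
      have "asks w (prod_encode (a, n)) (outp t)" using t an by (auto simp: asks_def)
      moreover have "outp t = 0 \<or> outp t = 1 \<and> lt p a b"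
        using l t an by (auto simp: certifies_def)
      ultimately show ?thesis
        using l v Y_iff[of a n] unfolding an char_fun_def by (auto split: if_splits)
    qed
    then show ?r using l by (auto simp: agrees_def certifies_def)
  next
    assume r: ?r
    have ask: "y = char_fun Y x" if "asks w x y" for x y
      using r that by (auto simp: agrees_def asks_def)
    have "outp t = 0 \<or> outp t = 1 \<and> lt p (pr1 (inp t)) b" if t: "t \<in> entries w" "prog t = 4" for t
    proof -
      obtain a n where an: "inp t = prod_encode (a, n)" by (metis prod_decode_inverse surj_pair)
      have "outp t = char_fun Y (prod_encode (a, n))"
        using r t unfolding agrees_def an[symmetric] by blast
      then show ?thesis using Y_iff[of a n] an by (auto simp: char_fun_def split: if_splits)
    qed
    moreover have "\<not> v (prod_encode (1, prod_encode (b, w)))"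
      unfolding v
      by (intro allI impI conjI; drule ask; auto simp: char_fun_def Y_iff split: if_splits)
    ultimately show ?l using r unfolding certifies_def by blast
  qed
qed

lemma stage_jump:
  assumes "\<And>a. lt p a b \<Longrightarrow> leq p a a" "\<exists>a. lt p a b" "leq p b b"
  shows "stage b = jump (char_fun {prod_encode (a, n) | a n. lt p a b \<and> n \<in> stage a})"
proof (intro set_eqI)
  fix e
  let ?Y = "{prod_encode (a, n) | a n. lt p a b \<and> n \<in> stage a}"
  have "e \<in> stage b \<longleftrightarrow> (\<exists>w. certifies p b e w \<and> \<not> v (prod_encode (1, prod_encode (b, w))))"
    using kernel_0[of b e] assms(2,3) by (auto simp: stage_def)
  also have "\<dots> \<longleftrightarrow> e \<in> jump (char_fun ?Y)"
  proof -
    have "certifies p b e w \<and> \<not> v (prod_encode (1, prod_encode (b, w))) \<longleftrightarrow>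
      derivation w \<and> agrees w (char_fun ?Y) \<and> (\<exists>t\<in>entries w. prog t = e \<and> inp t = e)" for w
      by (rule certifies_iff[OF _ assms(2) refl]) (rule assms(1))
    then show ?thesis unfolding mem_jump_iff by blast
  qed
  finally show "e \<in> stage b \<longleftrightarrow> e \<in> jump (char_fun ?Y)" .
qed

text \<open>At a first element every position with tag 1 is won by moving to tag 3, so no derivation
  survives and only the clause for \<open>start_set\<close> remains.\<close>

lemma stage_first:
  assumes "\<not> (\<exists>a. lt p a b)" "leq p b b"
  shows "stage b = {n. start_set p n}"
  using kernel_0[of b] kernel_1[of b] assms by (auto simp: stage_def)

lemma stage_hierarchy:
  assumes "Linear_order {(a, b). leq p a b}" "v (prod_encode (4, 0))"
  shows "jump_hierarchy {(a, b). leq p a b} {n. start_set p n} stage"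
proof -
  let ?L = "{(a, b). leq p a b}"
  have refl: "leq p a a \<longleftrightarrow> a \<in> Field ?L" for a
    using assms(1) by (auto simp: order_on_defs refl_on_def Field_def)
  have lt_field: "leq p a a" if "lt p a b" for a b
    using that refl by (auto simp: lt_def Field_def)
  obtain z where z: "leq p z z" "\<not> (\<exists>a. lt p a z)" using assms(2) kernel_4 by blast
  have least: "(z, a) \<in> ?L" if "a \<in> Field ?L" for a
  proof (cases "a = z")
    case False
    then have "leq p a z \<or> leq p z a"
      using assms(1) z(1) refl that by (auto simp: order_on_defs total_on_def)
    then show ?thesis using z(2) False by (auto simp: lt_def)
  qed (use z in simp)
  have "stage b = jump (char_fun {prod_encode (a, n) | a n. (a, b) \<in> ?L \<and> a \<noteq> b \<and> n \<in> stage a})"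
    if b: "b \<in> Field ?L" "b \<noteq> z" for b
  proof -
    have "lt p z b" using least b by (auto simp: lt_def)
    then show ?thesis
      using stage_jump[of b] lt_field b(1) refl by (auto simp: lt_def conj_assoc)
  qed
  moreover have "stage z = {n. start_set p n}" using stage_first z by blast
  moreover have "stage a = {}" if "a \<notin> Field ?L" for a using that refl by (simp add: stage_def)
  moreover have "z \<in> Field ?L" using z refl by blast
  ultimately show ?thesis using least unfolding jump_hierarchy_def by blast
qed

end

section \<open>Solutions from Koenig covers\<close>

lemma recursive_even_part [rec_intros]:
  "recursive f \<Longrightarrow> recursive (\<lambda>p n. even_part p (f p n))"
  unfolding even_part_def by (intro rec_intros)

lemma recursive_odd_part [rec_intros]:
  "recursive f \<Longrightarrow> recursive (\<lambda>p n. odd_part p (f p n))"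
  unfolding odd_part_def by (intro rec_intros)

definition graph_name :: "baire \<Rightarrow> baire" where
  "graph_name p = (\<lambda>_. 1) \<oplus>
     (\<lambda>m. of_bool (child (move p) (pr1 m) (pr2 m) \<or> child (move p) (pr2 m) (pr1 m)))"

lemma decidable_move: "decidable (\<lambda>p m. move p (pr1 m) (pr2 m))"
  unfolding move_def certifies_def asks_def start_set_def lt_def leq_def
  by (intro rec_intros)

lemma recursive_graph_name: "recursive graph_name"
proof -
  have "decidable (\<lambda>p m. child (move p) (pr1 m) (pr2 m) \<or> child (move p) (pr2 m) (pr1 m))"
    unfolding child_def
    by (intro rec_intros decidable_comp2[where P = move, OF decidable_move])
  then show ?thesis
    unfolding graph_name_def decidable_def by (intro recursive_join recursive_const)
qed

lemma set_rep_of_bool: "set_rep (\<lambda>n. of_bool (P n)) = Some {n. P n}"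
proof -
  have "(\<lambda>n. of_bool (P n)) = char_fun {n. P n}" by (auto simp: char_fun_def)
  then have "\<exists>A. (\<lambda>n. of_bool (P n)) = char_fun A" by blast
  then show ?thesis by (simp add: set_rep_def)
qed

lemma set_rep_Some: "set_rep p = Some A \<Longrightarrow> A = {n. p n = 1}"
  by (auto simp: set_rep_def split: if_splits)

lemma rel_rep_Some: "rel_rep p = Some R \<Longrightarrow> R = {(a, b). p (prod_encode (a, b)) = 1}"
  using set_rep_Some by (fastforce simp: rel_rep_def)

lemma prod_rep_Some:
  "prod_rep \<delta> \<epsilon> p = Some (a, b) \<longleftrightarrow> \<delta> (even_part p) = Some a \<and> \<epsilon> (odd_part p) = Some b"
  by (auto simp: prod_rep_def split: option.splits)

lemma graph_name_instance: "names_instance KDT (graph_name p) (UNIV, forest (move p))"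
proof -
  let ?D = "move p"
  let ?R = "{(a, b). child ?D a b \<or> child ?D b a}"
  have "set_rep (\<lambda>_. 1) = Some UNIV"
    using set_rep_of_bool[of "\<lambda>_. True"] by simp
  moreover have "edges_rep (\<lambda>m. of_bool (child ?D (pr1 m) (pr2 m) \<or> child ?D (pr2 m) (pr1 m)))
      = Some (forest ?D)"
  proof -
    have rel: "rel_rep (\<lambda>m. of_bool (child ?D (pr1 m) (pr2 m) \<or> child ?D (pr2 m) (pr1 m)))
        = Some ?R"
      unfolding rel_rep_def set_rep_of_bool by simp
    have "sym ?R" by (auto simp: sym_def)
    moreover have "irrefl ?R" using child_less by (auto simp: irrefl_def)
    moreover have "{{a, b} | a b. (a, b) \<in> ?R} = forest ?D"
      by (auto simp: forest_def insert_commute)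
    ultimately show ?thesis unfolding edges_rep_def rel by simp
  qed
  ultimately have "in_rep KDT (graph_name p) = Some (UNIV, forest ?D)"
    by (simp add: KDT_def prod_rep_Some graph_name_def)
  moreover have "(UNIV, forest ?D) \<in> instances KDT"
    using bipartite_forest konig_cover_forest by (auto simp: instances_def KDT_def)
  ultimately show ?thesis by (simp add: names_instance_def)
qed

section \<open>Reading a cover off its name\<close>

definition cover :: "baire \<Rightarrow> nat set" where
  "cover q = {x. even_part q x = 1}"

definition matched :: "baire \<Rightarrow> nat \<Rightarrow> nat \<Rightarrow> bool" where
  "matched q x y \<longleftrightarrow> odd_part q (prod_encode (x, y)) = 1"

lemma cover_solution:
  assumes "names_solution KDT (V, E) q"
  obtains M where "konig_cover E (cover q) M" "edge_in M = matched q"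
proof -
  obtain C M where CM: "set_rep (even_part q) = Some C" "edges_rep (odd_part q) = Some M"
    "konig_cover E C M"
    using assms by (auto simp: names_solution_def KDT_def prod_rep_Some split: if_splits)
  obtain R where R: "rel_rep (odd_part q) = Some R" "sym R" "M = {{a, b} | a b. (a, b) \<in> R}"
    using CM(2) by (auto simp: edges_rep_def split: option.splits if_splits)
  have "C = cover q" using set_rep_Some[OF CM(1)] by (simp add: cover_def)
  moreover have "edge_in M = matched q"
  proof (intro ext)
    fix x y
    have "(x, y) \<in> R" if "{x, y} = {a, b}" "(a, b) \<in> R" for a b
      using that R(2) by (auto simp: doubleton_eq_iff sym_def)
    then have "{x, y} \<in> M \<longleftrightarrow> (x, y) \<in> R" unfolding R(3) by blast
    then show "{x, y} \<in> M \<longleftrightarrow> matched q x y"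
      using rel_rep_Some[OF R(1)] by (simp add: matched_def)
  qed
  ultimately show ?thesis using CM(3) that by blast
qed

text \<open>
  The states of the search for a descending sequence: \<open>(0, b)\<close> when the cover says that there is
  no first element, and \<open>(1, y, y')\<close> for a fault \<open>y\<close>, \<open>y'\<close>.
\<close>

definition init :: "baire \<Rightarrow> nat \<Rightarrow> bool" where
  "init r \<sigma> \<longleftrightarrow>
     tag \<sigma> = 0 \<and> root (prod_encode (4, 0)) \<notin> cover (odd_part r) \<and>
       leq (even_part r) (pr2 \<sigma>) (pr2 \<sigma>) \<or>
     tag \<sigma> = 1 \<and> fault (cover (odd_part r)) (matched (odd_part r)) (pr1 (pr2 \<sigma>)) (pr2 (pr2 \<sigma>))"

text \<open>The successor of a fault \<open>y\<close>, \<open>y'\<close> is \<open>z'\<close>,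
  \<open>z\<close> as in \<open>fault_step\<close>; the crossed parent conditions reflect the swap
  of the two nodes.\<close>

definition step :: "baire \<Rightarrow> nat \<Rightarrow> nat \<Rightarrow> bool" where
  "step r \<sigma> \<tau> \<longleftrightarrow> init r \<tau> \<and> tag \<tau> = tag \<sigma> \<and>
     (tag \<sigma> = 0 \<longrightarrow> lt (even_part r) (pr2 \<tau>) (pr2 \<sigma>)) \<and>
     (tag \<sigma> = 1 \<longrightarrow>
        pr1 (pr1 (pr2 \<tau>)) = Suc (pr2 (pr2 \<sigma>)) \<and> pr1 (pr2 (pr2 \<tau>)) = Suc (pr1 (pr2 \<sigma>)) \<and>
        matched (odd_part r) (pr1 (pr2 \<sigma>)) (pr2 (pr2 \<tau>)))"

definition label :: "nat \<Rightarrow> nat" where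
  "label \<sigma> = (if tag \<sigma> = 0 then pr2 \<sigma> else lab (kind (pr1 (pr2 \<sigma>))))"

primrec search_seq :: "(nat \<Rightarrow> bool) \<Rightarrow> (nat \<Rightarrow> nat \<Rightarrow> bool) \<Rightarrow> nat \<Rightarrow> nat" where
  "search_seq I S 0 = (LEAST \<sigma>. I \<sigma>)"
| "search_seq I S (Suc n) = (LEAST \<tau>. S (search_seq I S n) \<tau>)"

lemma search_seq:
  assumes "\<exists>\<sigma>. I \<sigma>" "\<And>\<sigma>. I \<sigma> \<Longrightarrow> \<exists>\<tau>. S \<sigma> \<tau>" "\<And>\<sigma> \<tau>. S \<sigma> \<tau> \<Longrightarrow> I \<tau>"
  shows "I (search_seq I S n)" "S (search_seq I S n) (search_seq I S (Suc n))"
proof -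
  show I: "I (search_seq I S n)" for n
  proof (induction n)
    case 0
    show ?case using LeastI_ex[OF assms(1)] by simp
  next
    case (Suc n)
    show ?case using assms(3)[OF LeastI_ex[OF assms(2)[OF Suc]]] by simp
  qed
  show "S (search_seq I S n) (search_seq I S (Suc n))"
    using LeastI_ex[OF assms(2)[OF I[of n]]] by simp
qed

lemma search_seq_code:
  assumes "decidable I" "decidable (\<lambda>p m. S p (pr1 m) (pr2 m))"
  shows "\<exists>c. \<forall>p. (\<exists>\<sigma>. I p \<sigma>) \<longrightarrow> (\<forall>\<sigma>. I p \<sigma> \<longrightarrow> (\<exists>\<tau>. S p \<sigma> \<tau>)) \<longrightarrow>
    (\<forall>\<sigma> \<tau>. S p \<sigma> \<tau> \<longrightarrow> I p \<tau>) \<longrightarrow> computes c p (search_seq (I p) (S p))"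
proof -
  have "decidable (\<lambda>p m. I p (pr2 m))"
    by (rule decidable_comp[OF assms(1)]) (intro rec_intros)
  then obtain c where c: "\<And>p n. eval c p n = (if \<exists>\<sigma>. I p \<sigma> then Some (LEAST \<sigma>. I p \<sigma>) else None)"
    using search_code[of "\<lambda>p n. I p"] by blast
  have "decidable (\<lambda>p m. S p (pr2 (pr2 (pr1 m))) (pr2 m))"
    by (rule decidable_comp2[where P = S, OF assms(2)]) (intro rec_intros)+
  then obtain d where d: "\<And>p m. eval d p m =
      (if \<exists>\<tau>. S p (pr2 (pr2 m)) \<tau> then Some (LEAST \<tau>. S p (pr2 (pr2 m)) \<tau>) else None)"
    using search_code[of "\<lambda>p m. S p (pr2 (pr2 m))"] by blast
  \<comment> \<open>\<open>Prec\<close> receives the dummy parameter 0, and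
    \<open>Pair Left Right\<close> is the identity.\<close>
  have "computes (Comp (Prec c d) (Pair Zero (Pair Left Right))) p (search_seq (I p) (S p))"
    if "\<exists>\<sigma>. I p \<sigma>" "\<forall>\<sigma>. I p \<sigma> \<longrightarrow> (\<exists>\<tau>. S p \<sigma> \<tau>)" "\<forall>\<sigma> \<tau>. S p \<sigma> \<tau> \<longrightarrow> I p \<tau>" for p
  proof -
    have "rec_nat (eval c p 0)
        (\<lambda>k v. Option.bind v (\<lambda>r. eval d p (prod_encode (0, prod_encode (k, r))))) n
      = Some (search_seq (I p) (S p) n)" for n
    proof (induction n)
      case (Suc n)
      have "I p (search_seq (I p) (S p) n)" by (rule search_seq) (use that in blast)+
      then show ?case using Suc that(2) by (simp add: d)
    qed (use that in \<open>simp add: c\<close>)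
    then show ?thesis by (simp add: computes_def)
  qed
  then show ?thesis by blast
qed

lemma decidable_init: "decidable init"
  unfolding init_def fault_def good_def cover_def matched_def leq_def node_def
    mem_Collect_eq even_part_def odd_part_def
  by (intro rec_intros)

lemma decidable_step: "decidable (\<lambda>r m. step r (pr1 m) (pr2 m))"
  unfolding step_def lt_def leq_def matched_def even_part_def odd_part_def
  by (intro rec_intros decidable_comp[OF decidable_init])

text \<open>The leading 1 announces a hierarchy and shifts everything by one. The number
  \<open>n - 1\<close> codes a pair of a stage and a candidate member, so prefixing the tag 0 gives
  the position claiming that membership.\<close>

definition hierarchy_name :: "baire \<Rightarrow> baire" where
  "hierarchy_name r n = (if n = 0 then 1
     else of_bool (leq (even_part r) (pr1 (n - 1)) (pr1 (n - 1)) \<and>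
       root (prod_encode (0, n - 1)) \<in> cover (odd_part r)))"

lemma recursive_hierarchy_name: "recursive hierarchy_name"
proof -
  have "decidable (\<lambda>r n. leq (even_part r) (pr1 (n - 1)) (pr1 (n - 1)) \<and>
       root (prod_encode (0, n - 1)) \<in> cover (odd_part r))"
    unfolding leq_def node_def cover_def mem_Collect_eq even_part_def odd_part_def
    by (intro rec_intros)
  then have "recursive (\<lambda>r n. hierarchy_name r n)"
    unfolding hierarchy_name_def decidable_def by (intro rec_intros)
  then show ?thesis by simp
qed

text \<open>The leading 0 announces a descending sequence. Every third state is taken because of
  \<open>move_descends\<close>.\<close>

definition descent_name :: "baire \<Rightarrow> baire" where
  "descent_name r n =
     (if n = 0 then 0 else label (search_seq (init r) (step r) (3 * (n - 1))))"

lemma descent_code: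
  "\<exists>c. \<forall>r. (\<exists>\<sigma>. init r \<sigma>) \<longrightarrow> (\<forall>\<sigma>. init r \<sigma> \<longrightarrow> (\<exists>\<tau>. step r \<sigma> \<tau>)) \<longrightarrow>
    computes c r (descent_name r)"
proof -
  have init: "init r \<tau>" if "step r \<sigma> \<tau>" for r \<sigma> \<tau> using that by (simp add: step_def)
  obtain c where c: "\<And>r. \<exists>\<sigma>. init r \<sigma> \<Longrightarrow> \<forall>\<sigma>. init r \<sigma> \<longrightarrow> (\<exists>\<tau>. step r \<sigma> \<tau>) \<Longrightarrow>
      computes c r (search_seq (init r) (step r))"
    using search_seq_code[OF decidable_init decidable_step] init by blast
  have "recursive (\<lambda>r m. if pr1 m = 0 then 0 else label (pr2 m))"
    unfolding label_def by (intro rec_intros)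
  then obtain d where d: "\<And>r m. eval d r m = Some (if pr1 m = 0 then 0 else label (pr2 m))"
    unfolding recursive_def computes_def by blast
  have "recursive (\<lambda>r n. 3 * (n - 1))" by (intro rec_intros)
  then obtain e where e: "\<And>r n. eval e r n = Some (3 * (n - 1))"
    unfolding recursive_def computes_def by blast
  have "computes (Comp d (Pair (Pair Left Right) (Comp c e))) r (descent_name r)"
    if "\<exists>\<sigma>. init r \<sigma>" "\<forall>\<sigma>. init r \<sigma> \<longrightarrow> (\<exists>\<tau>. step r \<sigma> \<tau>)" for r
    using c[OF that] by (simp add: computes_def descent_name_def d e)
  then show ?thesis by blast
qed

lemma ATR2_instanceD:
  assumes "names_instance ATR2 p x"
  shows "x = ({(a, b). leq p a b}, {n. start_set p n})" "Linear_order {(a, b). leq p a b}"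
    "\<exists>a. leq p a a"
proof -
  obtain L A where x: "x = (L, A)" by fastforce
  have "rel_rep (even_part p) = Some L" "set_rep (odd_part p) = Some A"
    using assms x by (auto simp: names_instance_def ATR2_def prod_rep_Some)
  then have L: "L = {(a, b). leq p a b}" and A: "A = {n. start_set p n}"
    using rel_rep_Some set_rep_Some
    by (fastforce simp: leq_def start_set_def even_part_def odd_part_def)+
  then show "x = ({(a, b). leq p a b}, {n. start_set p n})" using x by simp
  have sols: "sols ATR2 (L, A) \<noteq> {}" using assms x by (simp add: names_instance_def instances_def)
  then show lin: "Linear_order {(a, b). leq p a b}"
    unfolding L by (auto simp: ATR2_def split: if_splits)
  \<comment> \<open>The empty ordering has neither kind of solution, hence is no instance.
    Non-emptiness lets a denied first element show up as a search state.\<close>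
  have "Field L \<noteq> {}"
  proof -
    from sols consider s where "descending L s" | X where "jump_hierarchy L A X"
      by (auto simp: ATR2_def split: if_splits)
    then show ?thesis
    proof cases
      case (1 s)
      then have "(s 1, s 0) \<in> L" by (simp add: descending_def)
      then show ?thesis by (auto simp: Field_def)
    qed (auto simp: jump_hierarchy_def)
  qed
  then show "\<exists>a. leq p a a"
    using lin unfolding L by (auto simp: order_on_defs refl_on_def)
qed

context
  fixes p q M
  assumes lin: "Linear_order {(a, b). leq p a b}"
    and K: "konig_cover (forest (move p)) (cover q) M" and M: "edge_in M = matched q"
begin

text \<open>No state is a dead end, so the mere existence of a state already guarantees an infinite
  search sequence.\<close>

lemma init_step: "init (p \<oplus> q) \<sigma> \<Longrightarrow> \<exists>\<tau>. step (p \<oplus> q) \<sigma> \<tau>"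
proof -
  assume \<sigma>: "init (p \<oplus> q) \<sigma>"
  then consider "tag \<sigma> = 0" "root (prod_encode (4, 0)) \<notin> cover q" "leq p (pr2 \<sigma>) (pr2 \<sigma>)"
    | "tag \<sigma> = 1" "fault (cover q) (matched q) (pr1 (pr2 \<sigma>)) (pr2 (pr2 \<sigma>))"
    by (auto simp: init_def)
  then show ?thesis
  proof cases
    case 1
    \<comment> \<open>As the claim of a first element is uncovered, the claim that
      \<open>pr2 \<sigma>\<close> is not first has a good covered copy; an uncovered child of it
      names a smaller element.\<close>
    have "move p (kind (root (prod_encode (4, 0)))) (prod_encode (3, prod_encode (pr2 \<sigma>, 0)))"
      using 1(3) by (simp add: move_def)
    from cover_child_in[OF K 1(2) this] obtain y where y:
      "kind y = prod_encode (3, prod_encode (pr2 \<sigma>, 0))" "y \<in> cover q" "good (cover q) (edge_in M) y"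
      by blast
    then obtain z where "child (move p) y z" using cover_child_out[OF K] by blast
    then have a: "lt p (lab (kind z)) (pr2 \<sigma>)" using y(1) by (auto simp: child_def move_def)
    then have "leq p (lab (kind z)) (lab (kind z))"
      using lin by (auto simp: order_on_defs refl_on_def lt_def Field_def)
    then have "step (p \<oplus> q) \<sigma> (prod_encode (0, lab (kind z)))"
      using 1 a by (simp add: step_def init_def)
    then show ?thesis ..
  next
    case 2
    then obtain z z' where "pr1 z = Suc (pr1 (pr2 \<sigma>))" "{pr1 (pr2 \<sigma>), z} \<in> M"
      "pr1 z' = Suc (pr2 (pr2 \<sigma>))" "fault (cover q) (matched q) z' z"
      using fault_step[OF K] unfolding M by blast
    then have "step (p \<oplus> q) \<sigma> (prod_encode (1, prod_encode (z', z)))"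
      using 2 fun_cong[OF fun_cong[OF M]] by (simp add: step_def init_def)
    then show ?thesis ..
  qed
qed

lemma descent_name_solution:
  assumes "\<exists>\<sigma>. init (p \<oplus> q) \<sigma>"
  shows "\<exists>s. atr_solution_rep (descent_name (p \<oplus> q)) = Some (Descending s) \<and>
    descending {(a, b). leq p a b} s"
proof -
  let ?r = "p \<oplus> q"
  define \<sigma> where "\<sigma> = search_seq (init ?r) (step ?r)"
  have seq: "init ?r (\<sigma> n)" "step ?r (\<sigma> n) (\<sigma> (Suc n))" for n
    unfolding \<sigma>_def using assms init_step by (rule search_seq; auto simp: step_def)+
  have trans: "lt p a c" if "lt p a b" "lt p b c" for a b c
    using that lin unfolding lt_def order_on_defs trans_def antisym_def by blast
  have tag: "tag (\<sigma> n) = tag (\<sigma> 0)" for n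
    by (induction n) (use seq(2) in \<open>auto simp: step_def\<close>)
  have "lt p (label (\<sigma> (n + 3))) (label (\<sigma> n))" for n
  proof (cases "tag (\<sigma> 0) = 0")
    case True
    then have "lt p (label (\<sigma> (Suc n))) (label (\<sigma> n))" for n
      using seq(2)[of n] tag[of n] tag[of "Suc n"] by (simp add: step_def label_def)
    then show ?thesis using trans by (metis add_Suc_right add.right_neutral numeral_3_eq_3)
  next
    case False
    then have 1: "tag (\<sigma> n) = 1" for n
      using seq(1)[of 0] tag[of n] by (auto simp: init_def)
    define t where "t n = kind (pr1 (pr2 (\<sigma> n)))" for n
    have "move p (t n) (t (Suc n))" for n
    proof -
      have "fault (cover q) (matched q) (pr1 (pr2 (\<sigma> (Suc n)))) (pr2 (pr2 (\<sigma> (Suc n))))"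
        using seq(1)[of "Suc n"] 1[of "Suc n"] by (simp add: init_def)
      \<comment> \<open>Both nodes of a fault have the same position, so the new position may be
        read at the node matched with the previous one.\<close>
      then have "t (Suc n) = kind (pr2 (pr2 (\<sigma> (Suc n))))" by (simp add: fault_def t_def)
      moreover have "{pr1 (pr2 (\<sigma> n)), pr2 (pr2 (\<sigma> (Suc n)))} \<in> M"
        using seq(2)[of n] 1[of n] fun_cong[OF fun_cong[OF M]] by (simp add: step_def)
      ultimately show ?thesis
        using matched_child_edge[OF K, of "pr1 (pr2 (\<sigma> n))" "pr2 (pr2 (\<sigma> (Suc n)))"]
          seq(2)[of n] 1[of n] by (simp add: step_def t_def)
    qed
    from move_descends[OF _ this this this this this, of n] trans
    have "lt p (lab (t (n + 3))) (lab (t n))" by (auto simp: numeral_3_eq_3)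
    then show ?thesis using 1 by (simp add: label_def t_def)
  qed
  from this[of "3 * n" for n] have "lt p (label (\<sigma> (3 * Suc n))) (label (\<sigma> (3 * n)))" for n
    by (simp add: add.commute)
  then have "descending {(a, b). leq p a b} (\<lambda>n. label (\<sigma> (3 * n)))"
    by (simp add: descending_def lt_def)
  then show ?thesis by (simp add: atr_solution_rep_def descent_name_def \<sigma>_def)
qed

lemma hierarchy_name_solution:
  assumes "\<nexists>\<sigma>. init (p \<oplus> q) \<sigma>" "\<exists>a. leq p a a"
  shows "\<exists>X. atr_solution_rep (hierarchy_name (p \<oplus> q)) = Some (Hierarchy X) \<and>
    jump_hierarchy {(a, b). leq p a b} {n. start_set p n} X"
proof -
  have "\<not> init (p \<oplus> q) (prod_encode (1, prod_encode (y, y')))" for y y' using assms(1) by blast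
  then have nf: "\<not> fault (cover q) (edge_in M) y y'" for y y' unfolding M by (simp add: init_def)
  interpret kernel p "\<lambda>t. root t \<in> cover q"
    by unfold_locales (rule no_fault_kernel[OF K nf])
  obtain a where "leq p a a" using assms(2) ..
  moreover have "\<not> init (p \<oplus> q) (prod_encode (0, a))" using assms(1) by blast
  ultimately have "root (prod_encode (4, 0)) \<in> cover q" by (simp add: init_def)
  then have "jump_hierarchy {(a, b). leq p a b} {n. start_set p n} stage"
    by (rule stage_hierarchy[OF lin])
  moreover have "atr_solution_rep (hierarchy_name (p \<oplus> q)) = Some (Hierarchy stage)"
    by (simp add: atr_solution_rep_def hierarchy_name_def family_rep_def rel_rep_def set_rep_of_bool
        stage_def fun_eq_iff)
  ultimately show ?thesis by blast
qed

end

text \<open>The common core of the three reducibilities: \<open>h\<close> writes down the question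
  to \<open>LPO\<close>, with a zero for each search state, and \<open>d1\<close>, \<open>d0\<close>
  are the programs for the answers yes and no. Each is asked to converge in its own case
  only.\<close>

lemma reduction_to_KDT:
  "\<exists>g h d0 d1. \<forall>p x. names_instance ATR2 p x \<longrightarrow>
     (\<exists>p' u. computes g p p' \<and> names_instance KDT p' u \<and>
       (\<forall>q. names_solution KDT u q \<longrightarrow>
         (\<exists>r s. computes h (p \<oplus> q) r \<and> computes (if \<exists>k. r k = 0 then d1 else d0) (p \<oplus> q) s \<and>
           names_solution ATR2 x s)))"
proof -
  obtain g where g: "\<And>p. computes g p (graph_name p)"
    using recursive_graph_name unfolding recursive_def by blast
  obtain h where h: "\<And>r. computes h r (\<lambda>k. of_bool (\<not> init r k))"
    using decidable_not[OF decidable_init] unfolding decidable_def recursive_def by blast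
  obtain d0 where d0: "\<And>r. computes d0 r (hierarchy_name r)"
    using recursive_hierarchy_name unfolding recursive_def by blast
  obtain d1 where d1: "\<And>r. \<exists>\<sigma>. init r \<sigma> \<Longrightarrow> \<forall>\<sigma>. init r \<sigma> \<longrightarrow> (\<exists>\<tau>. step r \<sigma> \<tau>) \<Longrightarrow>
      computes d1 r (descent_name r)"
    using descent_code by blast
  have "\<exists>r s. computes h (p \<oplus> q) r \<and> computes (if \<exists>k. r k = 0 then d1 else d0) (p \<oplus> q) s \<and>
      names_solution ATR2 x s"
    if x: "names_instance ATR2 p x" and q: "names_solution KDT (UNIV, forest (move p)) q" for p x q
  proof -
    note x' = ATR2_instanceD[OF x]
    obtain M where M: "konig_cover (forest (move p)) (cover q) M" "edge_in M = matched q"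
      using q by (rule cover_solution)
    show ?thesis
    proof (cases "\<exists>\<sigma>. init (p \<oplus> q) \<sigma>")
      case True
      then obtain s where "atr_solution_rep (descent_name (p \<oplus> q)) = Some (Descending s)"
        "descending {(a, b). leq p a b} s"
        using descent_name_solution[OF x'(2) M] by blast
      then have "names_solution ATR2 x (descent_name (p \<oplus> q))"
        using x' by (simp add: names_solution_def ATR2_def)
      moreover have "computes d1 (p \<oplus> q) (descent_name (p \<oplus> q))"
        using d1 True init_step[OF x'(2) M] by blast
      ultimately show ?thesis using h[of "p \<oplus> q"] True
        by (intro exI[of _ "\<lambda>k. of_bool (\<not> init (p \<oplus> q) k)"] exI[of _ "descent_name (p \<oplus> q)"]) auto
    next
      case False
      then obtain X where "atr_solution_rep (hierarchy_name (p \<oplus> q)) = Some (Hierarchy X)"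
        "jump_hierarchy {(a, b). leq p a b} {n. start_set p n} X"
        using hierarchy_name_solution[OF x'(2) M] x'(3) by blast
      then have "names_solution ATR2 x (hierarchy_name (p \<oplus> q))"
        using x' by (simp add: names_solution_def ATR2_def)
      then show ?thesis using h[of "p \<oplus> q"] d0 False
        by (intro exI[of _ "\<lambda>k. of_bool (\<not> init (p \<oplus> q) k)"] exI[of _ "hierarchy_name (p \<oplus> q)"]) auto
    qed
  qed
  then show ?thesis
    by (intro exI[of _ g] exI[of _ h] exI[of _ d0] exI[of _ d1] allI impI)
      (rule exI[of _ "graph_name _"], rule exI[of _ "(UNIV, forest (move _))"],
        intro conjI allI impI, rule g, rule graph_name_instance, blast)
qed

section \<open>Reducibilities in terms of programs\<close>

lemma computes_unique: "computes c p r \<Longrightarrow> computes c p s \<Longrightarrow> r = s"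
  by (auto simp: computes_def fun_eq_iff)

definition code_fun :: "code \<Rightarrow> baire \<rightharpoonup> baire" where
  "code_fun c p = (if \<exists>r. computes c p r then Some (THE r. computes c p r) else None)"

lemma code_fun_eq_Some: "code_fun c p = Some r \<longleftrightarrow> computes c p r"
proof -
  have "(THE r. computes c p r) = r" if "computes c p r" for r
    using that computes_unique by blast
  then show ?thesis unfolding code_fun_def by auto
qed

lemma weihrauch_iff:
  "P \<le>\<^sub>W Q \<longleftrightarrow> (\<exists>c d. \<forall>p x. names_instance P p x \<longrightarrow>
     (\<exists>p' u. computes c p p' \<and> names_instance Q p' u \<and>
       (\<forall>q. names_solution Q u q \<longrightarrow>
         (\<exists>r. computes d (p \<oplus> q) r \<and> names_solution P x r))))"
  (is "_ \<longleftrightarrow> (\<exists>c d. ?red c d)")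
proof
  assume "P \<le>\<^sub>W Q"
  then obtain \<Phi> \<Psi> where "computable \<Phi>" "computable \<Psi>" and red:
    "\<And>p x. names_instance P p x \<Longrightarrow> \<exists>p' u. \<Phi> p = Some p' \<and> names_instance Q p' u \<and>
      (\<forall>q. names_solution Q u q \<longrightarrow> (\<exists>r. \<Psi> (p \<oplus> q) = Some r \<and> names_solution P x r))"
    unfolding weihrauch_def reducible_via_def by blast
  then obtain c d where c: "\<And>p r. \<Phi> p = Some r \<Longrightarrow> computes c p r"
    and d: "\<And>p r. \<Psi> p = Some r \<Longrightarrow> computes d p r"
    unfolding computable_def computes_def by metis
  have "?red c d" using red c d by meson
  then show "\<exists>c d. ?red c d" by blast
next
  assume "\<exists>c d. ?red c d"
  then obtain c d where "?red c d" by blast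
  moreover have "computable (code_fun c)" for c
    unfolding computable_def code_fun_eq_Some computes_def by blast
  ultimately show "P \<le>\<^sub>W Q"
    unfolding weihrauch_def reducible_via_def
    by (intro exI[of _ "code_fun c"] exI[of _ "code_fun d"]) (simp add: code_fun_eq_Some)
qed

lemma weihrauchI:
  assumes "\<And>p x. names_instance P p x \<Longrightarrow>
     \<exists>p' u. computes c p p' \<and> names_instance Q p' u \<and>
       (\<forall>q. names_solution Q u q \<longrightarrow> (\<exists>r. computes d (p \<oplus> q) r \<and> names_solution P x r))"
  shows "P \<le>\<^sub>W Q"
  unfolding weihrauch_iff using assms by blast

lemma weihrauchE:
  assumes "P \<le>\<^sub>W Q"
  obtains c d where "\<And>p x. names_instance P p x \<Longrightarrow>
     \<exists>p' u. computes c p p' \<and> names_instance Q p' u \<and>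
       (\<forall>q. names_solution Q u q \<longrightarrow> (\<exists>r. computes d (p \<oplus> q) r \<and> names_solution P x r))"
  using assms unfolding weihrauch_iff by blast

section \<open>Programs for joins and projections, and transitivity\<close>

lemma recursive_code: "recursive f \<Longrightarrow> \<exists>c. \<forall>p. computes c p (f p)"
  by (simp add: recursive_def)

definition half_code :: code where
  "half_code = (SOME c. \<forall>p. computes c p (\<lambda>n. n div 2))"

definition select_code :: code where
  "select_code = (SOME c. \<forall>p. computes c p
     (\<lambda>m. if even (pr1 m) then pr1 (pr2 m) else pr2 (pr2 m)))"

text \<open>Both programs are run and the parity selects afterwards, which is safe when both are
  total on the given oracle.\<close>

definition join_code :: "code \<Rightarrow> code \<Rightarrow> code" where
  "join_code c d =
     Comp select_code (Pair (Pair Left Right) (Pair (Comp c half_code) (Comp d half_code)))"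

lemma computes_join:
  assumes "computes c p r" "computes d p s"
  shows "computes (join_code c d) p (r \<oplus> s)"
proof -
  have half: "\<forall>p. computes half_code p (\<lambda>n. n div 2)"
    unfolding half_code_def by (rule someI_ex[OF recursive_code]) (rule recursive_half)
  have "recursive (\<lambda>p m. if even (pr1 m) then pr1 (pr2 m) else pr2 (pr2 m))"
    by (intro rec_intros decidable_comp[OF decidable_even])
  from someI_ex[OF recursive_code[OF this]]
  have "\<forall>p. computes select_code p (\<lambda>m. if even (pr1 m) then pr1 (pr2 m) else pr2 (pr2 m))"
    unfolding select_code_def by blast
  with half assms show ?thesis
    by (simp add: computes_def join_code_def join_def)
qed

definition even_code :: code where
  "even_code = (SOME c. \<forall>p. computes c p (even_part p))"

definition odd_code :: code where
  "odd_code = (SOME c. \<forall>p. computes c p (odd_part p))"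

lemma computes_even: "computes even_code p (even_part p)"
proof -
  have "recursive (\<lambda>p n. even_part p n)" by (intro rec_intros)
  from someI_ex[OF recursive_code[OF this]] show ?thesis unfolding even_code_def by simp
qed

lemma computes_odd: "computes odd_code p (odd_part p)"
proof -
  have "recursive (\<lambda>p n. odd_part p n)" by (intro rec_intros)
  from someI_ex[OF recursive_code[OF this]] show ?thesis unfolding odd_code_def by simp
qed

lemma computes_oracle: "computes Oracle p p"
  by (simp add: computes_def)

lemma computes_join_left: "computes even_code (p \<oplus> q) p"
  and computes_join_right: "computes odd_code (p \<oplus> q) q"
  using computes_even[of "p \<oplus> q"] computes_odd[of "p \<oplus> q"] by simp_all

lemma weihrauch_trans:
  assumes "P \<le>\<^sub>W Q" "Q \<le>\<^sub>W R"
  shows "P \<le>\<^sub>W R"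
proof -
  obtain c d where cd: "\<And>p x. names_instance P p x \<Longrightarrow>
     \<exists>p' u. computes c p p' \<and> names_instance Q p' u \<and>
       (\<forall>q. names_solution Q u q \<longrightarrow> (\<exists>r. computes d (p \<oplus> q) r \<and> names_solution P x r))"
    using assms(1) by (rule weihrauchE) blast
  obtain c' d' where cd': "\<And>p x. names_instance Q p x \<Longrightarrow>
     \<exists>p' u. computes c' p p' \<and> names_instance R p' u \<and>
       (\<forall>q. names_solution R u q \<longrightarrow> (\<exists>r. computes d' (p \<oplus> q) r \<and> names_solution Q x r))"
    using assms(2) by (rule weihrauchE) blast
  \<comment> \<open>The intermediate name \<open>p'\<close> is not part of the input of the backward
    direction, so \<open>c\<close> recomputes it from \<open>p\<close>.\<close>
  let ?back = "subst (join_code (subst even_code c) odd_code) d'"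
  show ?thesis
  proof (rule weihrauchI[where c = "subst c c'" and d = "subst (join_code even_code ?back) d"])
    fix p x assume "names_instance P p x"
    from cd[OF this] obtain p' u where p': "computes c p p'" "names_instance Q p' u"
      and sol: "\<And>q. names_solution Q u q \<Longrightarrow> \<exists>r. computes d (p \<oplus> q) r \<and> names_solution P x r"
      by blast
    from cd'[OF p'(2)] obtain p2 w where p2: "computes c' p' p2" "names_instance R p2 w"
      and sol': "\<And>q. names_solution R w q \<Longrightarrow> \<exists>r. computes d' (p' \<oplus> q) r \<and> names_solution Q u r"
      by blast
    have "\<exists>r. computes (subst (join_code even_code ?back) d) (p \<oplus> q) r \<and> names_solution P x r"
      if q: "names_solution R w q" for q
    proof -
      obtain s where s: "computes d' (p' \<oplus> q) s" "names_solution Q u s" using sol'[OF q] by blast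
      obtain r where r: "computes d (p \<oplus> s) r" "names_solution P x r" using sol[OF s(2)] by blast
      have "computes (subst even_code c) (p \<oplus> q) p'"
        by (rule computes_subst[OF computes_join_left p'(1)])
      then have "computes ?back (p \<oplus> q) s"
        by (intro computes_subst[OF computes_join s(1)] computes_join_right)
      then have "computes (subst (join_code even_code ?back) d) (p \<oplus> q) r"
        by (intro computes_subst[OF computes_join r(1)] computes_join_left)
      then show ?thesis using r(2) by blast
    qed
    then show "\<exists>p' u. computes (subst c c') p p' \<and> names_instance R p' u \<and>
      (\<forall>q. names_solution R u q \<longrightarrow>
        (\<exists>r. computes (subst (join_code even_code ?back) d) (p \<oplus> q) r \<and> names_solution P x r))"
      using computes_subst[OF p'(1) p2(1)] p2(2) by blast
  qed
qed

text \<open>The universal program lets the oracle decide which program is run. Only the selected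
  program is evaluated, so the alternative may diverge, in contrast to
  \<open>recursive_if\<close>.\<close>

lemma dispatch_code:
  assumes "recursive (\<lambda>p n. f p)"
  shows "\<exists>e. \<forall>p r c s. f p = encode c \<longrightarrow> computes d p r \<longrightarrow> computes c r s \<longrightarrow> computes e p s"
proof -
  obtain u where u: "\<And>c p n. eval u p (prod_encode (encode c, n)) = eval c p n"
    using universal_code by blast
  have "recursive (\<lambda>p n. prod_encode (f p, n))" by (intro rec_intros assms)
  then obtain l where l: "\<And>p n. eval l p n = Some (prod_encode (f p, n))"
    unfolding recursive_def computes_def by blast
  show ?thesis
  proof (intro exI allI impI)
    fix p r c s assume "f p = encode c" "computes d p r" "computes c r s"
    then show "computes (Comp (subst d u) l) p s"
      using eval_subst[of d p r u] by (simp add: computes_def l u)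
  qed
qed

lemma names_solution_exists:
  assumes "is_problem P" "names_instance P p x"
  shows "\<exists>q. names_solution P x q"
proof -
  obtain y where y: "y \<in> sols P x" using assms(2) by (auto simp: names_instance_def instances_def)
  then have "y \<in> ran (out_rep P)" using assms(1) by (auto simp: is_problem_def)
  then show ?thesis using y by (auto simp: names_solution_def ran_def)
qed

lemma names_instance_unique: "names_instance P p x \<Longrightarrow> names_instance P p y \<Longrightarrow> x = y"
  by (simp add: names_instance_def)

section \<open>The compositional product\<close>

text \<open>
  An instance of the product consists of a program (by its number), a parameter and a name of an
  instance of \<open>P\<close>. From the parameter and any solution of that instance, the program computes a
  name of an instance of \<open>Q\<close>.
\<close>

definition run :: "baire \<Rightarrow> baire \<Rightarrow> baire \<Rightarrow> bool" where
  "run t q r \<longleftrightarrow>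
     (\<exists>c. encode c = even_part t 0 \<and> computes c (even_part (odd_part t) \<oplus> q) r)"

abbreviation inst :: "baire \<Rightarrow> baire" where "inst t \<equiv> odd_part (odd_part t)"

text \<open>The second stage sees nothing but the output of the first, so \<open>t\<close> is passed
  on along with \<open>q\<close>. The condition on all names of solutions secures that every output
  is an instance of the second stage.\<close>

definition stage1 :: "('u, 'v) problem \<Rightarrow> ('x, 'y) problem \<Rightarrow> (baire, baire) problem" where
  "stage1 Q P = \<lparr>in_rep = Some, out_rep = Some,
     sols = (\<lambda>t. {t \<oplus> q | q u. names_instance P (inst t) u \<and> names_solution P u q \<and>
       (\<forall>q. names_solution P u q \<longrightarrow> (\<exists>r w. run t q r \<and> names_instance Q r w))})\<rparr>"

text \<open>The solution of the first stage is kept beside \<open>s\<close>: the backward half of a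
  reduction to the product still has to reconstruct the intermediate value from it.\<close>

definition stage2 :: "('u, 'v) problem \<Rightarrow> (baire, baire) problem" where
  "stage2 Q = \<lparr>in_rep = Some, out_rep = Some,
     sols = (\<lambda>y. {odd_part y \<oplus> s | s r w. run (even_part y) (odd_part y) r \<and>
       names_instance Q r w \<and> names_solution Q w s})\<rparr>"

lemma run_unique: "run t q r \<Longrightarrow> run t q s \<Longrightarrow> r = s"
  unfolding run_def by (metis encode_inj computes_unique)

lemma names_instance_Some:
  "in_rep P = Some \<Longrightarrow> names_instance P p x \<longleftrightarrow> x = p \<and> sols P p \<noteq> {}"
  by (auto simp: names_instance_def instances_def)

lemma names_solution_Some: "out_rep P = Some \<Longrightarrow> names_solution P x q \<longleftrightarrow> q \<in> sols P x"
  by (simp add: names_solution_def)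

lemma stage1_reducible: "stage1 Q P \<le>\<^sub>W P"
proof (rule weihrauchI[where c = "subst odd_code odd_code" and d = Oracle])
  fix t x assume "names_instance (stage1 Q P) t x"
  then obtain u where "x = t" and u: "names_instance P (inst t) u"
    "\<forall>q. names_solution P u q \<longrightarrow> (\<exists>r w. run t q r \<and> names_instance Q r w)"
    by (auto simp: names_instance_Some stage1_def)
  then have "names_solution (stage1 Q P) x (t \<oplus> q)" if "names_solution P u q" for q
    using that by (auto simp: names_solution_Some stage1_def)
  then show "\<exists>p' u. computes (subst odd_code odd_code) t p' \<and> names_instance P p' u \<and>
    (\<forall>q. names_solution P u q \<longrightarrow>
      (\<exists>r. computes Oracle (t \<oplus> q) r \<and> names_solution (stage1 Q P) x r))"
    using u(1) computes_subst[OF computes_odd computes_odd] computes_oracle by blast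
qed

lemma stage2_reducible: "stage2 Q \<le>\<^sub>W Q"
proof -
  let ?d = "join_code (subst (subst even_code odd_code) even_code) odd_code"
  have "recursive (\<lambda>y n. even_part (even_part y) 0)"
    unfolding even_part_def by (intro rec_intros)
  from dispatch_code[OF this, of ?d] obtain e where e: "\<And>y r c s.
      even_part (even_part y) 0 = encode c \<Longrightarrow> computes ?d y r \<Longrightarrow> computes c r s \<Longrightarrow> computes e y s"
    by blast
  show ?thesis
  proof (rule weihrauchI[where c = e and d = "join_code (subst even_code odd_code) odd_code"])
    fix y x assume "names_instance (stage2 Q) y x"
    then obtain r w where x: "x = y" and r: "run (even_part y) (odd_part y) r" "names_instance Q r w"
      by (auto simp: names_instance_Some stage2_def)
    have d: "computes ?d y (even_part (odd_part (even_part y)) \<oplus> odd_part y)"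
      by (intro computes_join computes_odd
          computes_subst[OF computes_subst[OF computes_even computes_odd] computes_even])
    have "computes e y r" using r(1) e[OF _ d] unfolding run_def by metis
    moreover have "computes (join_code (subst even_code odd_code) odd_code) (y \<oplus> s)
        (odd_part y \<oplus> s)" for s
      by (intro computes_join computes_subst[OF computes_join_left] computes_odd computes_join_right)
    moreover have "names_solution (stage2 Q) x (odd_part y \<oplus> s)" if "names_solution Q w s" for s
      using that r x by (auto simp: names_solution_Some stage2_def)
    ultimately show "\<exists>p' u. computes e y p' \<and> names_instance Q p' u \<and>
      (\<forall>q. names_solution Q u q \<longrightarrow>
        (\<exists>r. computes (join_code (subst even_code odd_code) odd_code) (y \<oplus> q) r \<and>
          names_solution (stage2 Q) x r))"
      using r(2) by blast
  qed
qed

lemma is_problem_Some: "in_rep P = Some \<Longrightarrow> out_rep P = Some \<Longrightarrow> is_problem P"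
  by (auto simp: is_problem_def ran_def)

lemma stage_upper_bound:
  assumes P: "is_problem P" and Q: "is_problem Q"
  shows "comp_upper_bound Q P (composition (stage2 Q) (stage1 Q P))"
  unfolding comp_upper_bound_def
proof (intro allI impI, elim conjE)
  fix Q0 P0 :: "(baire, baire) problem"
  assume rep: "in_rep Q0 = out_rep P0" and "Q0 \<le>\<^sub>W Q" "P0 \<le>\<^sub>W P"
  obtain c0 d0 where c0: "\<And>p x. names_instance P0 p x \<Longrightarrow>
     \<exists>p' u. computes c0 p p' \<and> names_instance P p' u \<and>
       (\<forall>q. names_solution P u q \<longrightarrow> (\<exists>r. computes d0 (p \<oplus> q) r \<and> names_solution P0 x r))"
    using \<open>P0 \<le>\<^sub>W P\<close> by (rule weihrauchE) blast
  obtain c1 d1 where c1: "\<And>p x. names_instance Q0 p x \<Longrightarrow>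
     \<exists>p' u. computes c1 p p' \<and> names_instance Q p' u \<and>
       (\<forall>q. names_solution Q u q \<longrightarrow> (\<exists>r. computes d1 (p \<oplus> q) r \<and> names_solution Q0 x r))"
    using \<open>Q0 \<le>\<^sub>W Q\<close> by (rule weihrauchE) blast
  let ?S = "composition (stage2 Q) (stage1 Q P)"
  \<comment> \<open>The program stored in the instance recovers a solution of \<open>P0\<close> with
    \<open>d0\<close> and prepares the instance of \<open>Q\<close> from it with
    \<open>c1\<close>.\<close>
  define k where "k = encode (subst d0 c1)"
  obtain ck where ck: "\<And>p. computes ck p (\<lambda>_. k)"
    using recursive_const unfolding recursive_def by blast
  let ?pq = "join_code even_code (subst odd_code even_code)"
  let ?back = "subst (join_code (subst ?pq d0) (subst odd_code odd_code)) d1"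
  show "composition Q0 P0 \<le>\<^sub>W ?S"
  proof (rule weihrauchI[where c = "join_code ck (join_code Oracle c0)" and d = ?back])
    fix p x assume "names_instance (composition Q0 P0) p x"
    then have x: "in_rep P0 p = Some x" "sols P0 x \<noteq> {}" and sub: "sols P0 x \<subseteq> instances Q0"
      by (auto simp: names_instance_def composition_def instances_def split: if_splits)
    then have "names_instance P0 p x" by (simp add: names_instance_def instances_def)
    from c0[OF this] obtain p' u where p': "computes c0 p p'" and u: "names_instance P p' u"
      and d0: "\<And>q. names_solution P u q \<Longrightarrow> \<exists>r. computes d0 (p \<oplus> q) r \<and> names_solution P0 x r"
      by blast
    define t where "t = (\<lambda>_. k) \<oplus> (p \<oplus> p')"
    have t: "even_part t 0 = k" "even_part (odd_part t) = p" "inst t = p'" by (simp_all add: t_def)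
    have ct: "computes (join_code ck (join_code Oracle c0)) p t"
      unfolding t_def by (intro computes_join ck computes_oracle p')
    have inner: "\<exists>r0 r w. run t q r \<and> names_instance Q r w \<and> computes d0 (p \<oplus> q) r0 \<and>
        (\<forall>s. names_solution Q w s \<longrightarrow>
          (\<exists>z. computes d1 (r0 \<oplus> s) z \<and> names_solution (composition Q0 P0) x z))"
      if q: "names_solution P u q" for q
    proof -
      obtain r0 y where r0: "computes d0 (p \<oplus> q) r0" "out_rep P0 r0 = Some y" "y \<in> sols P0 x"
        using d0[OF q] by (auto simp: names_solution_def)
      \<comment> \<open>The common representation of the intermediate space lets the output name
        \<open>r0\<close> serve as an input name.\<close>
      then have "names_instance Q0 r0 y" using rep sub by (auto simp: names_instance_def)
      from c1[OF this] obtain r w where r: "computes c1 r0 r" "names_instance Q r w"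
        and z: "\<And>s. names_solution Q w s \<Longrightarrow> \<exists>z. computes d1 (r0 \<oplus> s) z \<and> names_solution Q0 y z"
        by blast
      have "run t q r"
        unfolding run_def t using k_def computes_subst[OF r0(1) r(1)] by blast
      moreover have "names_solution (composition Q0 P0) x z" if "names_solution Q0 y z" for z
        using that r0(3) sub by (auto simp: names_solution_def composition_def)
      ultimately show ?thesis using r0(1) r(2) z by blast
    qed
    have stage1: "sols (stage1 Q P) t = {t \<oplus> q | q. names_solution P u q}"
    proof -
      have "names_instance P (inst t) u' \<longleftrightarrow> u' = u" for u'
        using u names_instance_unique unfolding t by metis
      moreover have "\<forall>q. names_solution P u q \<longrightarrow> (\<exists>r w. run t q r \<and> names_instance Q r w)"
        using inner by blast
      ultimately show ?thesis by (auto simp: stage1_def)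
    qed
    have stage2: "sols (stage2 Q) (t \<oplus> q) \<noteq> {}" if "names_solution P u q" for q
    proof -
      obtain r w where "run t q r" "names_instance Q r w" using inner \<open>names_solution P u q\<close> by blast
      moreover obtain s where "names_solution Q w s"
        using names_solution_exists[OF Q] calculation(2) by blast
      ultimately show ?thesis by (auto simp: stage2_def)
    qed
    have sols: "sols ?S t = (\<Union>q\<in>{q. names_solution P u q}. sols (stage2 Q) (t \<oplus> q))"
      using stage1 stage2 by (auto simp: composition_def instances_def)
    have "sols ?S t \<noteq> {}"
      using names_solution_exists[OF P u] stage2 unfolding sols by blast
    then have t_inst: "names_instance ?S t t"
      by (subst names_instance_Some) (simp_all add: composition_def stage1_def)
    have "\<exists>r. computes ?back (p \<oplus> z) r \<and> names_solution (composition Q0 P0) x r"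
      if "names_solution ?S t z" for z
    proof -
      have "z \<in> sols ?S t"
        using that by (subst (asm) names_solution_Some) (simp_all add: composition_def stage2_def)
      then obtain q where q: "names_solution P u q" "z \<in> sols (stage2 Q) (t \<oplus> q)"
        unfolding sols by blast
      then obtain s r w where z: "z = q \<oplus> s" and "run t q r" "names_instance Q r w"
        "names_solution Q w s"
        by (auto simp: stage2_def)
      moreover obtain r0 r' w' where r0: "computes d0 (p \<oplus> q) r0"
        and "run t q r'" "names_instance Q r' w'" and
        d1: "\<And>s. names_solution Q w' s \<Longrightarrow>
          \<exists>z. computes d1 (r0 \<oplus> s) z \<and> names_solution (composition Q0 P0) x z"
        using inner[OF q(1)] by blast
      ultimately have "names_solution Q w' s" by (metis run_unique names_instance_unique)
      from d1[OF this] obtain z' where z': "computes d1 (r0 \<oplus> s) z'"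
        "names_solution (composition Q0 P0) x z'" by blast
      have "computes ?pq (p \<oplus> z) (p \<oplus> q)"
        unfolding z by (intro computes_join computes_join_left computes_subst[OF computes_join_right])
      then have "computes ?back (p \<oplus> z) z'"
        unfolding z
        by (intro computes_subst[OF computes_join z'(1)] computes_subst[OF _ r0]
            computes_subst[OF computes_join_right computes_join_right])
      then show ?thesis using z'(2) by blast
    qed
    with ct t_inst show "\<exists>p' u. computes (join_code ck (join_code Oracle c0)) p p' \<and>
        names_instance ?S p' u \<and>
        (\<forall>q. names_solution ?S u q \<longrightarrow>
          (\<exists>r. computes ?back (p \<oplus> q) r \<and> names_solution (composition Q0 P0) x r))"
      by blast
  qed
qed

text \<open>The composition of the two stages is an upper bound, and since its factors reduce to
  \<open>P\<close> and \<open>Q\<close>, every upper bound dominates it. Hence it is a supremum,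
  which gives the choice operator in the definition something to choose.\<close>

lemma comp_product_upper_bound:
  assumes "is_problem P" "is_problem Q"
  shows "comp_upper_bound Q P (Q \<^bold>* P)"
proof -
  have reps: "in_rep (stage1 Q P) = Some" "out_rep (stage1 Q P) = Some"
    "in_rep (stage2 Q) = Some" "out_rep (stage2 Q) = Some"
    by (simp_all add: stage1_def stage2_def)
  have "is_comp_product Q P (composition (stage2 Q) (stage1 Q P))"
    unfolding is_comp_product_def
  proof (intro conjI allI impI, goal_cases)
    case 1
    show ?case by (rule is_problem_Some) (simp_all add: composition_def reps)
  next
    case 2
    show ?case by (rule stage_upper_bound[OF assms])
  next
    case (3 T)
    then show ?case
      using stage1_reducible stage2_reducible is_problem_Some reps
      unfolding comp_upper_bound_def by metis
  qed
  then have "is_comp_product Q P (Q \<^bold>* P)" unfolding comp_product_def by (rule someI)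
  then show ?thesis by (simp add: is_comp_product_def)
qed

section \<open>The reductions to Koenig duality\<close>

lemma is_problem_LPO: "is_problem LPO"
proof -
  have "n \<in> ran nat_rep" for n by (rule ranI[of _ "\<lambda>_. n"]) (simp add: nat_rep_def)
  then show ?thesis by (auto simp: is_problem_def LPO_def ran_def)
qed

lemma set_rep_char_fun: "set_rep (char_fun A) = Some A"
  by (auto simp: set_rep_def char_fun_def)

lemma edges_rep_surj:
  assumes "\<And>e. e \<in> E \<Longrightarrow> \<exists>a b. a \<noteq> b \<and> e = {a, b}"
  shows "\<exists>p. edges_rep p = Some E"
proof -
  let ?R = "{(a, b). {a, b} \<in> E}"
  have "rel_rep (char_fun {m. prod_decode m \<in> ?R}) = Some ?R"
    by (simp add: rel_rep_def set_rep_char_fun)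
  moreover have "sym ?R" by (auto simp: sym_def insert_commute)
  moreover have "irrefl ?R" using assms by (fastforce simp: irrefl_def)
  moreover have "{{a, b} | a b. (a, b) \<in> ?R} = E" using assms by blast
  ultimately show ?thesis
    by (intro exI[of _ "char_fun {m. prod_decode m \<in> ?R}"]) (simp add: edges_rep_def)
qed

lemma is_problem_KDT: "is_problem KDT"
proof -
  have ran: "(V, E) \<in> ran (prod_rep set_rep edges_rep)"
    if E: "\<And>e. e \<in> E \<Longrightarrow> \<exists>a b. a \<noteq> b \<and> e = {a, b}" for V E
  proof -
    obtain p where "edges_rep p = Some E" using edges_rep_surj[OF E] by blast
    then have "prod_rep set_rep edges_rep (char_fun V \<oplus> p) = Some (V, E)"
      by (simp add: prod_rep_Some set_rep_char_fun)
    then show ?thesis unfolding ran_def by blast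
  qed
  have edge: "\<exists>a b. a \<noteq> b \<and> e = {a, b}" if "bipartite_graph V E" "e \<in> E" for V E e
    using that unfolding bipartite_graph_def by (metis disjoint_iff)
  show ?thesis
    unfolding is_problem_def
  proof (intro conjI allI subsetI)
    fix u assume "u \<in> instances KDT"
    moreover obtain V E where "u = (V, E)" by fastforce
    ultimately show "u \<in> ran (in_rep KDT)"
      using ran edge by (auto simp: instances_def KDT_def split: if_splits)
  next
    fix u s assume "s \<in> sols KDT u"
    moreover obtain V E C M where "u = (V, E)" "s = (C, M)" by fastforce
    ultimately have *: "bipartite_graph V E" "M \<subseteq> E" "s = (C, M)"
      by (auto simp: KDT_def konig_cover_def split: if_splits)
    then have "(C, M) \<in> ran (prod_rep set_rep edges_rep)"
      by (intro ran edge[OF *(1)]) blast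
    then show "s \<in> ran (out_rep KDT)" by (simp add: KDT_def *(3))
  qed
qed

lemma encode_mem_jump: "encode c \<in> jump p \<longleftrightarrow> eval c p (encode c) \<noteq> None"
  unfolding jump_def by (auto dest!: encode_inj)

text \<open>An arithmetical function gets only the iterated jump as oracle, so \<open>p\<close> must
  be recovered: its value at \<open>n\<close> is the only \<open>m\<close> for which a program
  testing that equation halts.\<close>

lemma recover_oracle_code: "\<exists>c. \<forall>p. computes c (char_fun (jump p)) p"
proof -
  define const where "const = rec_nat Zero (\<lambda>_. Comp Succ)"
  have const: "eval (const n) p x = Some n" for n p x by (induction n) (simp_all add: const_def)
  have "decidable (\<lambda>p m. pr1 (pr1 m) \<noteq> pr2 (pr1 m))"
    by (intro rec_intros)
  then obtain d where d: "\<And>p m. eval d p m = Some (of_bool (pr1 (pr1 m) \<noteq> pr2 (pr1 m)))"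
    unfolding decidable_def recursive_def computes_def by blast
  \<comment> \<open>The test \<open>d\<close> ignores the search counter, so the search stops at
    once if the oracle has value \<open>m\<close> at \<open>n\<close> and never otherwise. The
    constants make this independent of the input.\<close>
  define test where
    "test n m = Comp (Find d) (Pair (Comp Oracle (const n)) (const m))" for n m
  have test: "encode (test n m) \<in> jump p \<longleftrightarrow> p n = m" for n m p
  proof -
    have "encode (test n m) \<in> jump p \<longleftrightarrow> eval (test n m) p (encode (test n m)) \<noteq> None"
      by (rule encode_mem_jump)
    also have "\<dots> \<longleftrightarrow> p n = m" by (simp add: test_def const d)
    finally show ?thesis .
  qed
  define e where "e = encode (Find d)"
  \<comment> \<open>The numbers of the tests must be recursive in \<open>n\<close> and
    \<open>m\<close>; 6 and 1 come from the codes of \<open>Comp\<close> and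
    \<open>Succ\<close>.\<close>
  have enc_const: "encode (const n) = rec_nat 0 (\<lambda>_ r. 6 + 4 * prod_encode (1, r)) n" for n
    by (induction n) (simp_all add: const_def)
  have "recursive (\<lambda>p m. encode (test (pr1 m) (pr2 m)))"
    unfolding test_def encode.simps enc_const e_def[symmetric, unfolded encode.simps]
    by (intro rec_intros recursive_rec_nat)
  then have "decidable (\<lambda>p m. p (encode (test (pr1 m) (pr2 m))) = 1)"
    by (intro rec_intros)
  from search_code[of "\<lambda>p n m. p (encode (test n m)) = 1", OF this] obtain c where
    c: "\<And>p n. eval c p n = (if \<exists>m. p (encode (test n m)) = 1
      then Some (LEAST m. p (encode (test n m)) = 1) else None)" by blast
  have "eval c (char_fun (jump p)) n = Some (p n)" for p n
  proof -
    have "char_fun (jump p) (encode (test n m)) = 1 \<longleftrightarrow> p n = m" for m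
      by (simp add: char_fun_def test)
    then show ?thesis by (simp add: c Least_equality)
  qed
  then show ?thesis by (auto simp: computes_def)
qed

theorem theorem9p25:
  shows "ATR2 \<le>\<^sub>W LPO \<^bold>* KDT \<and> ATR2 \<le>\<^sub>c KDT \<and> ATR2 \<le>\<^sub>W\<^sup>a KDT"
proof -
  obtain g h d0 d1 where red: "\<And>p x. names_instance ATR2 p x \<Longrightarrow>
     \<exists>p' u. computes g p p' \<and> names_instance KDT p' u \<and>
       (\<forall>q. names_solution KDT u q \<longrightarrow>
         (\<exists>r s. computes h (p \<oplus> q) r \<and> computes (if \<exists>k. r k = 0 then d1 else d0) (p \<oplus> q) s \<and>
           names_solution ATR2 x s))"
    using reduction_to_KDT by blast
  \<comment> \<open>The product is reached through an explicit pair: \<open>P0\<close> keeps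
    \<open>p\<close> next to the cover, and \<open>Q0\<close> asks whether a search state exists and
    runs the corresponding program.\<close>
  define P0 :: "(baire, baire) problem" where "P0 = \<lparr>in_rep = Some, out_rep = Some,
    sols = (\<lambda>p. {p \<oplus> q | q x p' u. names_instance ATR2 p x \<and> computes g p p' \<and>
      names_instance KDT p' u \<and> names_solution KDT u q})\<rparr>"
  define Q0 :: "(baire, baire) problem" where "Q0 = \<lparr>in_rep = Some, out_rep = Some,
    sols = (\<lambda>y. {s. \<exists>r. computes h y r \<and> computes (if \<exists>k. r k = 0 then d1 else d0) y s})\<rparr>"
  have reps: "in_rep P0 = Some" "out_rep P0 = Some" "in_rep Q0 = Some" "out_rep Q0 = Some"
    by (simp_all add: P0_def Q0_def)
  have sols_P0: "sols P0 p = {p \<oplus> q | q x p' u. names_instance ATR2 p x \<and> computes g p p' \<and>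
      names_instance KDT p' u \<and> names_solution KDT u q}" for p
    by (simp only: P0_def problem.simps)
  have sols_Q0: "sols Q0 y = {s. \<exists>r. computes h y r \<and>
      computes (if \<exists>k. r k = 0 then d1 else d0) y s}" for y
    by (simp only: Q0_def problem.simps)
  have P0: "P0 \<le>\<^sub>W KDT"
  proof (rule weihrauchI[where c = g and d = Oracle])
    fix p x assume "names_instance P0 p x"
    then have "x = p" "sols P0 p \<noteq> {}" by (simp_all add: names_instance_Some reps)
    then obtain x' p' u where "names_instance ATR2 p x'" "computes g p p'" "names_instance KDT p' u"
      by (auto simp: P0_def)
    moreover from this have "names_solution P0 x (p \<oplus> q)" if "names_solution KDT u q" for q
      using that unfolding names_solution_Some[OF reps(2)] \<open>x = p\<close> sols_P0 by blast
    ultimately show "\<exists>p' u. computes g p p' \<and> names_instance KDT p' u \<and>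
      (\<forall>q. names_solution KDT u q \<longrightarrow> (\<exists>r. computes Oracle (p \<oplus> q) r \<and> names_solution P0 x r))"
      using computes_oracle by blast
  qed
  have Q0: "Q0 \<le>\<^sub>W LPO"
  proof -
    \<comment> \<open>Only the number of the program is selected here, since \<open>d1\<close> may
      diverge when the answer is 0.\<close>
    have "recursive (\<lambda>y n. if odd_part y 0 = 1 then encode d1 else encode d0)"
      unfolding odd_part_def by (intro rec_intros)
    from dispatch_code[OF this, of even_code] obtain e where e: "\<And>y c r s.
        (if odd_part y 0 = 1 then encode d1 else encode d0) = encode c \<Longrightarrow> computes even_code y r \<Longrightarrow>
        computes c r s \<Longrightarrow> computes e y s"
      by blast
    show ?thesis
    proof (rule weihrauchI[where c = h and d = e])
      fix y x assume "names_instance Q0 y x"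
      then obtain r s where x: "x = y" and r: "computes h y r"
        and s: "computes (if \<exists>k. r k = 0 then d1 else d0) y s"
        by (auto simp: names_instance_Some reps) (auto simp: Q0_def)
      have "computes e (y \<oplus> b) s" if "names_solution LPO r b" for b
      proof (rule e[OF _ computes_join_left s])
        have "b 0 = (if \<exists>k. r k = 0 then 1 else 0)"
          using that by (simp add: names_solution_def LPO_def nat_rep_def)
        then have "odd_part (y \<oplus> b) 0 = 1 \<longleftrightarrow> (\<exists>k. r k = 0)"
          unfolding odd_part_join by (metis zero_neq_one)
        then show "(if odd_part (y \<oplus> b) 0 = 1 then encode d1 else encode d0) =
            encode (if \<exists>k. r k = 0 then d1 else d0)"
          by (simp only: if_distrib[of encode])
      qed
      moreover have "names_solution Q0 x s"
        using r s unfolding x names_solution_Some[OF reps(4)] sols_Q0 by blast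
      moreover have "names_instance LPO r r"
        by (subst names_instance_Some) (simp_all add: LPO_def)
      ultimately show "\<exists>p' u. computes h y p' \<and> names_instance LPO p' u \<and>
        (\<forall>q. names_solution LPO u q \<longrightarrow> (\<exists>r. computes e (y \<oplus> q) r \<and> names_solution Q0 x r))"
        using r by blast
    qed
  qed
  have "ATR2 \<le>\<^sub>W composition Q0 P0"
  proof (rule weihrauchI[where c = Oracle and d = odd_code])
    fix p x assume x: "names_instance ATR2 p x"
    from red[OF x] obtain p' u where p': "computes g p p'" "names_instance KDT p' u"
      and sol: "\<And>q. names_solution KDT u q \<Longrightarrow> \<exists>r s. computes h (p \<oplus> q) r \<and>
        computes (if \<exists>k. r k = 0 then d1 else d0) (p \<oplus> q) s \<and> names_solution ATR2 x s"
      by blast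
    have P0_sols: "sols P0 p = {p \<oplus> q | q. names_solution KDT u q}"
    proof -
      have "b = u" if "computes g p a" "names_instance KDT a b" for a b
      proof -
        have "a = p'" by (rule computes_unique[OF that(1) p'(1)])
        then show ?thesis using that(2) p'(2) by (simp add: names_instance_def)
      qed
      then show ?thesis using x p' unfolding sols_P0 by blast
    qed
    have Q0_sols: "names_solution ATR2 x s"
      if q: "names_solution KDT u q" and s: "s \<in> sols Q0 (p \<oplus> q)" for q s
    proof -
      obtain r s' where r: "computes h (p \<oplus> q) r" and
        s': "computes (if \<exists>k. r k = 0 then d1 else d0) (p \<oplus> q) s'" "names_solution ATR2 x s'"
        using sol[OF q] by blast
      obtain r' where r': "computes h (p \<oplus> q) r'"
        "computes (if \<exists>k. r' k = 0 then d1 else d0) (p \<oplus> q) s"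
        using s unfolding sols_Q0 by blast
      have "r' = r" by (rule computes_unique[OF r'(1) r])
      then have "s = s'" using computes_unique[OF _ s'(1)] r'(2) by blast
      then show ?thesis using s'(2) by simp
    qed
    have "sols Q0 (p \<oplus> q) \<noteq> {}" if "names_solution KDT u q" for q
      using sol[OF that] unfolding sols_Q0 by blast
    then have sols: "sols (composition Q0 P0) p = (\<Union>q\<in>{q. names_solution KDT u q}. sols Q0 (p \<oplus> q))"
      using P0_sols by (auto simp: composition_def instances_def)
    have "sols (composition Q0 P0) p \<noteq> {}"
      using names_solution_exists[OF is_problem_KDT p'(2)] \<open>\<And>q. _ \<Longrightarrow> sols Q0 (p \<oplus> q) \<noteq> {}\<close>
      unfolding sols by blast
    then have "names_instance (composition Q0 P0) p p"
      by (subst names_instance_Some) (simp_all add: composition_def reps)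
    moreover have "names_solution ATR2 x s" if "names_solution (composition Q0 P0) p s" for s
    proof -
      have "s \<in> sols (composition Q0 P0) p"
        using that by (subst (asm) names_solution_Some) (simp_all add: composition_def reps)
      then show ?thesis unfolding sols using Q0_sols by blast
    qed
    ultimately show "\<exists>p' u. computes Oracle p p' \<and> names_instance (composition Q0 P0) p' u \<and>
      (\<forall>q. names_solution (composition Q0 P0) u q \<longrightarrow>
        (\<exists>r. computes odd_code (p \<oplus> q) r \<and> names_solution ATR2 x r))"
      using computes_oracle computes_join_right by blast
  qed
  moreover have "composition Q0 P0 \<le>\<^sub>W LPO \<^bold>* KDT"
  proof -
    have "comp_upper_bound LPO KDT (LPO \<^bold>* KDT)"
      by (rule comp_product_upper_bound[OF is_problem_KDT is_problem_LPO])
    moreover have "is_problem Q0 \<and> is_problem P0 \<and> in_rep Q0 = out_rep P0 \<and>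
        Q0 \<le>\<^sub>W LPO \<and> P0 \<le>\<^sub>W KDT"
      using P0 Q0 is_problem_Some[OF reps(1,2)] is_problem_Some[OF reps(3,4)] by (simp add: reps)
    ultimately show ?thesis
      unfolding comp_upper_bound_def by (elim allE[of _ Q0] allE[of _ P0] impE)
  qed
  ultimately have 1: "ATR2 \<le>\<^sub>W LPO \<^bold>* KDT" by (rule weihrauch_trans)
  have 2: "ATR2 \<le>\<^sub>c KDT"
    unfolding comp_reducible_def
  proof (intro allI impI)
    fix p x assume "names_instance ATR2 p x"
    from red[OF this] obtain p' u where p': "computes g p p'" "names_instance KDT p' u"
      and sol: "\<And>q. names_solution KDT u q \<Longrightarrow> \<exists>r s. computes h (p \<oplus> q) r \<and>
        computes (if \<exists>k. r k = 0 then d1 else d0) (p \<oplus> q) s \<and> names_solution ATR2 x s"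
      by blast
    have turing: "r \<le>\<^sub>T y" if "computes c y r" for c y r
      using that by (auto simp: turing_reducible_def computes_def)
    \<comment> \<open>Non-uniformly, the right one of \<open>d0\<close> and \<open>d1\<close> may be
      fixed separately for each \<open>p\<close> and \<open>q\<close>.\<close>
    have "\<exists>r. r \<le>\<^sub>T p \<oplus> q \<and> names_solution ATR2 x r" if "names_solution KDT u q" for q
      using sol[OF that] turing by blast
    then show "\<exists>p' u. p' \<le>\<^sub>T p \<and> names_instance KDT p' u \<and>
        (\<forall>q. names_solution KDT u q \<longrightarrow> (\<exists>r. r \<le>\<^sub>T p \<oplus> q \<and> names_solution ATR2 x r))"
      using turing[OF p'(1)] p'(2) by blast
  qed
  have 3: "ATR2 \<le>\<^sub>W\<^sup>a KDT"
  proof -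
    \<comment> \<open>On every input this search halts exactly if the answer of \<open>LPO\<close>
      is 1, so one bit of the jump replaces the call of \<open>LPO\<close>.\<close>
    define e where "e = encode (Find (Comp h Right))"
    have halts: "e \<in> jump y \<longleftrightarrow> (\<exists>k. r k = 0)" if "computes h y r" for y r
    proof -
      have "e \<in> jump y \<longleftrightarrow> eval (Find (Comp h Right)) y e \<noteq> None"
        unfolding e_def by (rule encode_mem_jump)
      also have "\<dots> \<longleftrightarrow> (\<exists>k. r k = 0)" using that by (simp add: computes_def)
      finally show ?thesis .
    qed
    obtain f where f: "\<And>y. computes f (char_fun (jump y)) y" using recover_oracle_code by blast
    have "recursive (\<lambda>j n. if j e = 1 then encode d1 else encode d0)" by (intro rec_intros)
    from dispatch_code[OF this, of f] obtain d where d: "\<And>j c r s.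
        (if j e = 1 then encode d1 else encode d0) = encode c \<Longrightarrow> computes f j r \<Longrightarrow>
        computes c r s \<Longrightarrow> computes d j s"
      by blast
    define \<Psi> where "\<Psi> y = code_fun d (char_fun (jump y))" for y
    have "arithmetical (code_fun g)"
      unfolding arithmetical_def code_fun_eq_Some computes_def
      by (intro exI[of _ 0] exI[of _ g]) simp
    moreover have "arithmetical \<Psi>"
      unfolding arithmetical_def \<Psi>_def code_fun_eq_Some computes_def
      by (intro exI[of _ 1] exI[of _ d]) simp
    moreover have run: "\<Psi> y = Some s"
      if "computes h y r" "computes (if \<exists>k. r k = 0 then d1 else d0) y s" for y r s
    proof -
      have "char_fun (jump y) e = 1 \<longleftrightarrow> (\<exists>k. r k = 0)"
        unfolding halts[OF that(1), symmetric] by (simp add: char_fun_def)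
      then have "(if char_fun (jump y) e = 1 then encode d1 else encode d0) =
          encode (if \<exists>k. r k = 0 then d1 else d0)"
        by (simp only: if_distrib[of encode])
      from d[OF this f that(2)] show ?thesis unfolding \<Psi>_def code_fun_eq_Some .
    qed
    moreover have "\<exists>p' u. code_fun g p = Some p' \<and> names_instance KDT p' u \<and>
        (\<forall>q. names_solution KDT u q \<longrightarrow> (\<exists>r. \<Psi> (p \<oplus> q) = Some r \<and> names_solution ATR2 x r))"
      if x: "names_instance ATR2 p x" for p x
    proof -
      from red[OF x] obtain p' u where p': "computes g p p'" "names_instance KDT p' u"
        and sol: "\<And>q. names_solution KDT u q \<Longrightarrow> \<exists>r s. computes h (p \<oplus> q) r \<and>
          computes (if \<exists>k. r k = 0 then d1 else d0) (p \<oplus> q) s \<and> names_solution ATR2 x s"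
        by blast
      have "\<exists>r. \<Psi> (p \<oplus> q) = Some r \<and> names_solution ATR2 x r" if "names_solution KDT u q" for q
        using sol[OF that] run by blast
      then show ?thesis using p' unfolding code_fun_eq_Some by blast
    qed
    ultimately show ?thesis
      unfolding arith_weihrauch_def reducible_via_def
      by (intro exI[of _ "code_fun g"] exI[of _ \<Psi>]) simp
  qed
  show ?thesis using 1 2 3 by blast
qed

end
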